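(* For $k\in\{0,\tfrac12,1,\tfrac32,2,\dots\}$ and every $0<a<1$, $$\int_0^a\left(\frac{f(-q^5)}{f(-q)}\right)^{6k+5} f(-q)^4\,q^{k}\,dq=F\!\left[\begin{matrix}11+2i+u(a),\;11-2i+u(a),\;u(a)\\ 1/2,\;1/2,\;k+1\end{matrix}\right],$$ where $u(a)=\frac{1}{R(a)^5}-11-R(a)^5$.
   Context: For $0<q<1$, $f(-q)=\prod_{n\ge1}(1-q^n)$ and $R(q)$ is the Rogers–Ramanujan continued fraction $R(q)=\dfrac{q^{1/5}}{1+\dfrac{q}{1+\dfrac{q^2}{1+\dfrac{q^3}{1+\cdots}}}}$ (positive real fifth root). For complex $A,B,C$ and exponents $\lambda,\mu,\nu$, $F\!\left[\begin{matrix}A,B,C\\ \lambda,\mu,\nu\end{matrix}\right]:=\int_0^\infty\frac{dx}{(x+A)^{\lambda}(x+B)^{\mu}(x+C)^{\nu}}$, with principal branches of the powers. *)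

theory Defs
  imports "HOL-Analysis.Analysis"
begin

(* Ramanujan's f, so that ramanujan_f (-q) = (1 - q) (1 - q^2) (1 - q^3) ... for \<bar>q\<bar> < 1. *)
definition ramanujan_f :: "real \<Rightarrow> real" where
  "ramanujan_f x = (\<Prod>n. 1 - (- x) ^ Suc n)"

(* rr_denom q j n = 1 + q^(j+1) / (1 + q^(j+2) / (... / (1 + q^(j+n) / 1))). *)
fun rr_denom :: "real \<Rightarrow> nat \<Rightarrow> nat \<Rightarrow> real" where
  "rr_denom q j 0 = 1"
| "rr_denom q j (Suc n) = 1 + q ^ Suc j / rr_denom q (Suc j) n"

(* The continued fraction is the limit of its convergents. *)
definition rogers_ramanujan_cf :: "real \<Rightarrow> real" where
  "rogers_ramanujan_cf q = lim (\<lambda>n. root 5 q / rr_denom q 0 n)"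

definition rr_u :: "real \<Rightarrow> real" where
  "rr_u a = 1 / rogers_ramanujan_cf a ^ 5 - 11 - rogers_ramanujan_cf a ^ 5"

(* powr on the complex numbers is the principal branch. *)
definition F_integrand ::
  "complex \<Rightarrow> complex \<Rightarrow> complex \<Rightarrow> complex \<Rightarrow> complex \<Rightarrow> complex \<Rightarrow> real \<Rightarrow> complex" where
  "F_integrand A B C l m n x =
     1 / ((of_real x + A) powr l * (of_real x + B) powr m * (of_real x + C) powr n)"

(* The Henstock-Kurzweil integral includes improper Riemann integrals. *)
definition F_integral ::
  "complex \<Rightarrow> complex \<Rightarrow> complex \<Rightarrow> complex \<Rightarrow> complex \<Rightarrow> complex \<Rightarrow> complex" where
  "F_integral A B C l m n = integral {0..} (F_integrand A B C l m n)"

end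

theory Submission
  imports Defs "HOL-Real_Asymp.Real_Asymp"
begin

text \<open>
  With \<open>f = f(-q)\<close> and \<open>f\<^sub>5 = f(-q\<^sup>5)\<close>, two classical identities turn the left integral into the right one by the
  substitution \<open>x = u(q) - u(a)\<close>, which maps \<open>(0, a]\<close> decreasingly onto \<open>[0, \<infinity>)\<close>:
  \<open>u = f\<^sup>6 / (q f\<^sub>5\<^sup>6)\<close> and \<open>q (d/dq) log R\<^sup>5 = f\<^sup>5 / f\<^sub>5\<close>, the latter giving
  \<open>q u' = - sqrt ((u + 11)\<^sup>2 + 4) f\<^sup>5 / f\<^sub>5\<close> because \<open>R\<^sup>-\<^sup>5 + R\<^sup>5 = sqrt ((u + 11)\<^sup>2 + 4)\<close>.

  Rogers' \<open>q\<close>-difference equations give \<open>R\<^sup>5 = q (H / G)\<^sup>5\<close> for the theta series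
  \<open>G = \<Sum> (-1)\<^sup>n q\<^bsup>n(5n+1)/2\<^esup>\<close> and \<open>H = \<Sum> (-1)\<^sup>n q\<^bsup>n(5n+3)/2\<^esup>\<close>, and \<open>G H = f f\<^sub>5\<close> by the triple product.
  Both identities are then rearrangements of sums over the Gaussian integers along multiplication by \<open>2 + i\<close>:
  sorting the product \<open>G H\<close> by residues modulo 5 gives \<open>f f\<^sub>5 = G\<^sub>5\<^sup>2 - q G\<^sub>5 H\<^sub>5 - q\<^sup>2 H\<^sub>5\<^sup>2\<close> with
  \<open>G\<^sub>5 = G(q\<^sup>5)\<close> and \<open>H\<^sub>5 = H(q\<^sup>5)\<close>, whose product over \<open>q \<mapsto> \<omega>\<^sup>k q\<close>, \<open>k < 5\<close>, is the first identity
  at \<open>q\<^sup>5\<close>; and the Wronskian of \<open>G\<close> and \<open>H\<close> becomes the square of Jacobi's series for \<open>f\<^sup>3\<close>, which is the second.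
\<close>

section \<open>Absolute summability and the index-five sublattice\<close>

text \<open>Completing squares explains the role of 2 + i. Since 20(5n^2 + bn) + b^2 = (10n + b)^2,
  the product of G and H runs over Gaussian integers X + iY with X congruent to 3 and Y to 1 modulo
  10. Because 3 + i = (2 - i)(1 + i), such a number is 2 - i times some U + iV with U and V odd, and
  pairs of odd numbers index the square of Jacobi's series. The square (10n + b)^2 is also what
  differentiation of a theta series brings down. Two constraints shape the setting. The product over
  fifth roots of unity leaves the reals, so theta series and infinite products live in a general
  complete normed field, and the result is transferred back to real arguments. The left integrand is
  an infinite product for which no direct estimate at q = 0 is made: absolute integrability is
  proved for the elementary right integrand and carried over by the substitution.\<close>

lemma summable_poly_geometric:
  fixes r :: real
  assumes "0 \<le> r" "r < 1"
  shows "summable (\<lambda>n. (1 + real n) ^ k * r ^ n)"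
proof (cases "r = 0")
  case True
  then show ?thesis
    by (intro summable_finite[of "{0}"]) auto
next
  case False
  define s where "s = (1 + r) / 2"
  have s: "0 < r" "r < s" "s < 1" using assms False by (auto simp: s_def)
  have "(\<lambda>n. (1 + real n) ^ k * r ^ n) \<in> O(\<lambda>n. s ^ n)"
    using s by real_asymp
  moreover have "summable (\<lambda>n. norm (s ^ n))"
    using s by (simp add: norm_power)
  ultimately show ?thesis
    using summable_comparison_test_bigo by blast
qed

lemma summable_on_int_poly_geometric:
  fixes r :: real
  assumes "0 \<le> r" "r < 1"
  shows "(\<lambda>n::int. (1 + \<bar>real_of_int n\<bar>) ^ k * r ^ nat \<bar>n\<bar>) summable_on UNIV"
proof -
  let ?f = "\<lambda>n::int. (1 + \<bar>real_of_int n\<bar>) ^ k * r ^ nat \<bar>n\<bar>"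
  have nat: "(\<lambda>n. (1 + real n) ^ k * r ^ n) summable_on UNIV"
  proof (rule norm_summable_imp_summable_on)
    have "norm ((1 + real n) ^ k * r ^ n) = (1 + real n) ^ k * r ^ n" for n
      using assms(1) by (simp add: abs_mult)
    then show "summable (\<lambda>n. norm ((1 + real n) ^ k * r ^ n))"
      using summable_poly_geometric[OF assms, of k] by (simp only:)
  qed
  have 1: "?f summable_on (range int)"
    using nat summable_on_reindex[of int UNIV ?f] by (simp add: o_def)
  have "inj (\<lambda>n. - int n)" by (simp add: inj_def)
  from summable_on_reindex[OF this, of ?f] have 2: "?f summable_on (range (\<lambda>n. - int n))"
    using nat by (simp only: o_def abs_minus_cancel abs_of_nat of_int_minus of_int_of_nat_eq nat_int)
  have "range int \<union> range (\<lambda>n. - int n) = UNIV"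
  proof (intro equalityI subsetI)
    fix x :: int
    show "x \<in> range int \<union> range (\<lambda>n. - int n)"
      by (cases x rule: int_cases2) auto
  qed simp
  with summable_on_union[OF 1 2] show ?thesis by simp
qed

text \<open>Linear growth of the exponent is enough for comparison with a geometric series. The
  constant offset absorbs the finitely many negative exponents that occur when |b| exceeds
  a.\<close>

lemma quadratic_ge_abs:
  fixes a b n :: int
  assumes "0 < a"
  shows "\<bar>n\<bar> - (\<bar>b\<bar> + 1)\<^sup>2 \<le> a * n\<^sup>2 + b * n"
proof -
  let ?c = "\<bar>b\<bar> + 1"
  have "0 \<le> (\<bar>n\<bar> - ?c)\<^sup>2 + ?c * \<bar>n\<bar>"
    by (intro add_nonneg_nonneg mult_nonneg_nonneg) auto
  also have "\<dots> = n\<^sup>2 - \<bar>b * n\<bar> - \<bar>n\<bar> + ?c\<^sup>2"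
    by (simp add: power2_eq_square algebra_simps abs_mult)
  finally have "\<bar>n\<bar> - ?c\<^sup>2 \<le> 1 * n\<^sup>2 - \<bar>b * n\<bar>" by simp
  also have "\<dots> \<le> a * n\<^sup>2 - \<bar>b * n\<bar>"
    using assms by (intro diff_right_mono mult_right_mono) auto
  also have "\<dots> \<le> a * n\<^sup>2 + b * n"
    by simp
  finally show ?thesis .
qed

text \<open>The polynomially bounded weight \<open>c\<close> lets one estimate serve the plain theta
  series, their moments and Jacobi's series for the cube.\<close>

lemma theta_abs_summable:
  fixes p :: "'a :: real_normed_field" and c :: "int \<Rightarrow> 'a"
  assumes "p \<noteq> 0" "norm p < 1" "0 < a"
    and c: "\<And>n. norm (c n) \<le> K * (1 + \<bar>real_of_int n\<bar>) ^ k"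
  shows "(\<lambda>n. norm (c n * p powi (a * n\<^sup>2 + b * n))) summable_on UNIV"
proof (rule summable_on_comparison_test)
  let ?r = "norm p"
  show "(\<lambda>n. K * inverse (?r powi (\<bar>b\<bar> + 1)\<^sup>2) * ((1 + \<bar>real_of_int n\<bar>) ^ k * ?r ^ nat \<bar>n\<bar>)) summable_on UNIV"
    using assms by (intro summable_on_cmult_right summable_on_int_poly_geometric) auto
next
  let ?r = "norm p"
  fix n :: int
  have "?r powi (a * n\<^sup>2 + b * n) \<le> ?r powi (\<bar>n\<bar> - (\<bar>b\<bar> + 1)\<^sup>2)"
    using quadratic_ge_abs[of a n b] assms by (intro power_int_decreasing) auto
  also have "\<dots> = inverse (?r powi (\<bar>b\<bar> + 1)\<^sup>2) * ?r ^ nat \<bar>n\<bar>"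
    using assms(1) by (simp add: power_int_diff power_int_nonneg_exp field_simps)
  finally have "norm (c n) * ?r powi (a * n\<^sup>2 + b * n)
     \<le> (K * (1 + \<bar>real_of_int n\<bar>) ^ k) * (inverse (?r powi (\<bar>b\<bar> + 1)\<^sup>2) * ?r ^ nat \<bar>n\<bar>)"
    by (intro mult_mono c order.trans[OF norm_ge_zero c]) auto
  then show "norm (c n * p powi (a * n\<^sup>2 + b * n)) 
     \<le> K * inverse (?r powi (\<bar>b\<bar> + 1)\<^sup>2) * ((1 + \<bar>real_of_int n\<bar>) ^ k * ?r ^ nat \<bar>n\<bar>)"
    by (simp add: norm_mult norm_power_int mult_ac)
qed auto

lemma abs_summable_on_Times:
  fixes f :: "'a \<Rightarrow> 'c :: {real_normed_field, banach, second_countable_topology}" and g :: "'b \<Rightarrow> 'c"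
  assumes "(\<lambda>x. norm (f x)) summable_on UNIV" "(\<lambda>x. norm (g x)) summable_on UNIV"
  shows "(\<lambda>z. norm (case z of (x, y) \<Rightarrow> f x * g y)) summable_on UNIV"
    and "((\<lambda>(x, y). f x * g y) has_sum (infsum f UNIV * infsum g UNIV)) UNIV"
proof -
  show abs: "(\<lambda>z. norm (case z of (x, y) \<Rightarrow> f x * g y)) summable_on UNIV"
  proof -
    have "(\<lambda>x. \<bar>norm (f x) * (\<Sum>\<^sub>\<infinity>y. norm (g y))\<bar>) summable_on UNIV"
      using assms(1) by (simp add: abs_mult infsum_nonneg summable_on_cmult_left)
    then show ?thesis
      using Infinite_Sum.abs_summable_on_Sigma_iff[of "\<lambda>(x, y). f x * g y" UNIV "\<lambda>_. UNIV"] assms(2)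
      by (simp add: norm_mult infsum_cmult_right' summable_on_cmult_right case_prod_unfold)
  qed
  have "infsum (\<lambda>(x, y). f x * g y) (UNIV \<times> UNIV) = infsum f UNIV * infsum g UNIV"
    using abs abs_summable_summable
    by (subst infsum_Sigma'_banach[symmetric]) 
       (auto simp: infsum_cmult_right' infsum_cmult_left')
  then show "((\<lambda>(x, y). f x * g y) has_sum (infsum f UNIV * infsum g UNIV)) UNIV"
    using abs abs_summable_summable by (metis UNIV_Times_UNIV has_sum_infsum)
qed

text \<open>As Gaussian integers, s + it = (2 + i)(m + in) + di. The norm of 2 + i is 5 and 0, i,
  ..., 4i represent its residue classes; the class of s + it is read off from t - 3s modulo 5, and
  the quotient is n - m.\<close>

lemma bij_lattice5:
  "bij_betw (\<lambda>(d, m, n). (2 * m - n, m + 2 * n + d)) ({0..<5} \<times> UNIV) (UNIV :: (int \<times> int) set)"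
proof (rule bij_betw_byWitness[where f' = "\<lambda>(s, t). 
   let d = (t - 3 * s) mod 5; e = (t - 3 * s) div 5 in (d, s + e, s + 2 * e)"])
  show "\<forall>a\<in>{0..<5} \<times> UNIV. (\<lambda>(s, t). 
   let d = (t - 3 * s) mod 5; e = (t - 3 * s) div 5 in (d, s + e, s + 2 * e))
     ((\<lambda>(d, m, n). (2 * m - n, m + 2 * n + d)) a) = (a :: int \<times> int \<times> int)"
  proof
    fix x :: "int \<times> int \<times> int" assume "x \<in> {0..<5} \<times> UNIV"
    then obtain d m n where x: "x = (d, m, n)" and d: "d \<in> {0..<5}" by auto
    have "m + 2 * n + d - 3 * (2 * m - n) = d + (n - m) * 5" by simp
    then have "(m + 2 * n + d - 3 * (2 * m - n)) mod 5 = d" 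
      "(m + 2 * n + d - 3 * (2 * m - n)) div 5 = n - m" 
      using d by (simp_all only: mod_mult_self1 div_mult_self1) auto
    then show "(\<lambda>(s, t). let d = (t - 3 * s) mod 5; e = (t - 3 * s) div 5 in (d, s + e, s + 2 * e))
     ((\<lambda>(d, m, n). (2 * m - n, m + 2 * n + d)) x) = x"
      unfolding x prod.case Let_def by (simp only:) simp
  qed
  show "\<forall>a\<in>UNIV. (\<lambda>(d, m, n). (2 * m - n, m + 2 * n + d)) ((\<lambda>(s, t). 
   let d = (t - 3 * s) mod 5; e = (t - 3 * s) div 5 in (d, s + e, s + 2 * e)) a) = (a :: int \<times> int)"
  proof
    fix x :: "int \<times> int"
    obtain s t where x: "x = (s, t)" by (cases x)
    show "(\<lambda>(d, m, n). (2 * m - n, m + 2 * n + d)) ((\<lambda>(s, t). 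
   let d = (t - 3 * s) mod 5; e = (t - 3 * s) div 5 in (d, s + e, s + 2 * e)) x) = x"
      unfolding x using div_mult_mod_eq[of "t - 3 * s" 5] by (simp add: Let_def)
  qed
qed (auto simp: Let_def)

lemma infsum_lattice5:
  fixes f :: "int \<times> int \<Rightarrow> 'c :: banach"
  assumes "f summable_on UNIV"
  shows "infsum f UNIV = (\<Sum>d\<in>{0..<5}. \<Sum>\<^sub>\<infinity>(m, n). f (2 * m - n, m + 2 * n + d))"
proof -
  let ?g = "\<lambda>(d, m, n). (2 * m - n, m + 2 * n + d) :: int \<times> int"
  let ?A = "{0..<5} \<times> (UNIV :: (int \<times> int) set)"
  have "infsum f UNIV = infsum (\<lambda>x. f (?g x)) ?A"
    by (rule infsum_reindex_bij_betw[OF bij_lattice5, symmetric])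
  also have "\<dots> = infsum (\<lambda>(d, mn). f (?g (d, mn))) (Sigma {0..<5} (\<lambda>_. UNIV))"
    by (simp add: case_prod_unfold)
  also have "\<dots> = (\<Sum>\<^sub>\<infinity>d\<in>{0..<5}. \<Sum>\<^sub>\<infinity>mn. f (?g (d, mn)))"
  proof (rule infsum_Sigma'_banach[symmetric])
    have "(\<lambda>x. f (?g x)) summable_on ?A"
      using assms
      by (subst summable_on_reindex_bij_betw[OF bij_lattice5])
    then show "(\<lambda>(d, mn). f (?g (d, mn))) summable_on (Sigma {0..<5} (\<lambda>_. UNIV))"
      by (simp add: case_prod_unfold)
  qed
  finally show ?thesis by (simp add: case_prod_unfold)
qed

section \<open>Theta series\<close>

text \<open>
  The first argument is a square root \<open>p\<close> of the nome \<open>q\<close>, so that the exponents \<open>n(5n+1)/2\<close> and \<open>n(5n+3)/2\<close> of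
  \<open>q\<close> become integer polynomials: \<open>G(q) = theta p 5 1\<close> and \<open>H(q) = theta p 5 3\<close>.
\<close>

definition theta :: "'a :: {real_normed_field, banach, second_countable_topology} \<Rightarrow> int \<Rightarrow> int \<Rightarrow> 'a" where
  "theta p a b = (\<Sum>\<^sub>\<infinity>n. (-1) powi n * p powi (a * n\<^sup>2 + b * n))"

lemma norm_minus_one_powi [simp]: "norm ((-1 :: 'a :: real_normed_div_algebra) powi n) = 1"
  by (simp add: norm_power_int)

lemma minus_one_powi: "(-1 :: 'a :: field) powi n = (if even n then 1 else - 1)"
  by (simp add: power_int_minus_left)

lemma theta_summable:
  fixes p :: "'a :: {real_normed_field, banach, second_countable_topology}"
  assumes "p \<noteq> 0" "norm p < 1" "0 < a"
  shows "(\<lambda>n. norm ((-1) powi n * p powi (a * n\<^sup>2 + b * n))) summable_on UNIV"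
  using assms by (intro theta_abs_summable[where K = 1 and k = 0]) auto

lemma theta_uminus: "theta p a (- b) = theta p a b"
  unfolding theta_def
  by (rule infsum_reindex_bij_witness[of _ uminus uminus]) (auto simp: minus_one_powi)

text \<open>Quasi-periodicity, from replacing n by n + 1. Together with the reflection
  \<open>theta_uminus\<close> it reduces every linear coefficient to the range from 0 to a.\<close>

lemma theta_shift:
  assumes "p \<noteq> 0"
  shows "theta p a b = - (p powi (a - b)) * theta p a (b - 2 * a)"
proof -
  have "theta p a b = (\<Sum>\<^sub>\<infinity>n. - (p powi (a - b)) * ((-1) powi n * p powi (a * n\<^sup>2 + (b - 2 * a) * n)))"
    unfolding theta_def
  proof (rule infsum_reindex_bij_witness[of _ "\<lambda>n. n - 1" "\<lambda>n. n + 1"])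
    fix n :: int
    have e: "a * (n + 1)\<^sup>2 + (b - 2 * a) * (n + 1) = (a * n\<^sup>2 + b * n) + (b - a)"
      by (simp add: power2_eq_square algebra_simps)
    have s: "(-1 :: 'a) powi (n + 1) = - ((-1) powi n)"
      by (simp add: minus_one_powi)
    have "p powi (a - b) * p powi ((a * n\<^sup>2 + b * n) + (b - a)) = p powi ((a - b) + ((a * n\<^sup>2 + b * n) + (b - a)))"
      using assms by (intro power_int_add[symmetric]) auto
    also have "(a - b) + ((a * n\<^sup>2 + b * n) + (b - a)) = a * n\<^sup>2 + b * n" by simp
    finally have "p powi (a - b) * p powi ((a * n\<^sup>2 + b * n) + (b - a)) = p powi (a * n\<^sup>2 + b * n)" .
    then show "- (p powi (a - b)) * ((-1) powi (n + 1) * p powi (a * (n + 1)\<^sup>2 + (b - 2 * a) * (n + 1)))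
        = (-1) powi n * p powi (a * n\<^sup>2 + b * n)"
      unfolding e s by (simp only: mult_minus_left mult_minus_right minus_minus mult.left_commute)
  qed auto
  then show ?thesis
    unfolding theta_def by (simp add: infsum_cmult_right' infsum_uminus)
qed

text \<open>The shift sends the coefficient a to -a with factor -1, and reflection returns it to a:
  the terms at n and -1 - n cancel.\<close>

lemma theta_eq_0:
  assumes "p \<noteq> 0"
  shows "theta p a a = 0"
proof -
  have "theta p a a = - theta p a a"
    using theta_shift[OF assms, of a a] theta_uminus[of p a a] by simp
  then have "2 * theta p a a = 0"
    by (simp only: mult_2 eq_neg_iff_add_eq_0)
  then show ?thesis by simp
qed

lemma theta_product_expansion:
  fixes p :: "'a :: {real_normed_field, banach, second_countable_topology}"
  assumes p: "p \<noteq> 0" "norm p < 1"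
  shows "theta p 5 1 * theta p 5 3 =
         (theta p 25 5)\<^sup>2 - p ^ 2 * theta p 25 5 * theta p 25 15 - p ^ 4 * (theta p 25 15)\<^sup>2"
proof -
  let ?t = "\<lambda>a b n. (-1) powi n * p powi (a * n\<^sup>2 + b * n)"
  let ?f = "\<lambda>(x, y). ?t 5 (-3) x * ?t 5 1 y"
  have sm: "(\<lambda>n. norm (?t a b n)) summable_on UNIV" if "0 < a" for a b
    by (rule theta_summable) (use p that in auto)
  have padd: "p powi (i + j) = p powi i * p powi j" for i j
    using p(1) by (simp add: power_int_add)
  \<comment> \<open>The sign of 3 matters. With -3 the linear coefficients on the sublattice, 10d -
    5 and 20d + 5, are multiples of 5, so every class is a product of theta series in the nome q^5;
    with +3 they are not.\<close>
  have "theta p 5 1 * theta p 5 3 = theta p 5 (-3) * theta p 5 1"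
    by (simp add: theta_uminus)
  also have "\<dots> = infsum ?f UNIV"
    unfolding theta_def using abs_summable_on_Times(2)[OF sm[of 5 "-3"] sm[of 5 1]]
    by (simp add: infsumI)
  also have "\<dots> = (\<Sum>d\<in>{0..<5}. \<Sum>\<^sub>\<infinity>(m, n). ?f (2 * m - n, m + 2 * n + d))"
    by (rule infsum_lattice5[OF has_sum_imp_summable[OF abs_summable_on_Times(2)[OF sm sm]]]) auto
  also have "\<dots> = (\<Sum>d\<in>{0..<5}. (-1) powi d * p powi (5 * d\<^sup>2 + d) * (theta p 25 (10 * d - 5) * theta p 25 (20 * d + 5)))"
  proof (rule sum.cong)
    fix d :: int
    have "(\<Sum>\<^sub>\<infinity>(m, n). ?f (2 * m - n, m + 2 * n + d))
        = (\<Sum>\<^sub>\<infinity>(m, n). (-1) powi d * p powi (5 * d\<^sup>2 + d) * (?t 25 (10 * d - 5) m * ?t 25 (20 * d + 5) n))"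
    proof (rule infsum_cong, clarify)
      fix m n :: int
      have e: "5 * (2 * m - n)\<^sup>2 + - 3 * (2 * m - n) + (5 * (m + 2 * n + d)\<^sup>2 + 1 * (m + 2 * n + d))
         = (5 * d\<^sup>2 + d) + (25 * m\<^sup>2 + (10 * d - 5) * m) + (25 * n\<^sup>2 + (20 * d + 5) * n)"
        by (simp add: power2_eq_square algebra_simps)
      have s: "(-1 :: 'a) powi (2 * m - n) * (-1) powi (m + 2 * n + d) = (-1) powi d * ((-1) powi m * (-1) powi n)"
        by (simp add: minus_one_powi)
      have "?t 5 (-3) (2 * m - n) * ?t 5 1 (m + 2 * n + d) = 
        ((-1 :: 'a) powi (2 * m - n) * (-1) powi (m + 2 * n + d)) * 
         p powi (5 * (2 * m - n)\<^sup>2 + - 3 * (2 * m - n) + (5 * (m + 2 * n + d)\<^sup>2 + 1 * (m + 2 * n + d)))"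
        by (simp only: padd mult_ac)
      also have "\<dots> = (-1) powi d * p powi (5 * d\<^sup>2 + d) * (?t 25 (10 * d - 5) m * ?t 25 (20 * d + 5) n)"
        unfolding e s by (simp only: padd mult_ac)
      finally show "?t 5 (-3) (2 * m - n) * ?t 5 1 (m + 2 * n + d) = 
          (-1) powi d * p powi (5 * d\<^sup>2 + d) * (?t 25 (10 * d - 5) m * ?t 25 (20 * d + 5) n)" .
    qed
    also have "\<dots> = (\<Sum>\<^sub>\<infinity>z. (-1) powi d * p powi (5 * d\<^sup>2 + d) * (case z of (m, n) \<Rightarrow> ?t 25 (10 * d - 5) m * ?t 25 (20 * d + 5) n))"
      by (simp add: case_prod_unfold)
    also have "\<dots> = (-1) powi d * p powi (5 * d\<^sup>2 + d) * (theta p 25 (10 * d - 5) * theta p 25 (20 * d + 5))"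
      unfolding theta_def using abs_summable_on_Times(2)[OF sm[of 25 "10 * d - 5"] sm[of 25 "20 * d + 5"]]
      by (simp add: infsum_cmult_right' infsumI)
    finally show "(\<Sum>\<^sub>\<infinity>(m, n). ?f (2 * m - n, m + 2 * n + d)) = \<dots>" .
  qed simp
  also have "{0..<5::int} = {0, 1, 2, 3, 4}" by auto
  also have "(\<Sum>d\<in>\<dots>. (-1) powi d * p powi (5 * d\<^sup>2 + d) * (theta p 25 (10 * d - 5) * theta p 25 (20 * d + 5)))
     = theta p 25 (-5) * theta p 25 5 - p powi 6 * (theta p 25 5 * theta p 25 25)
      + p powi 22 * (theta p 25 15 * theta p 25 45) - p powi 48 * (theta p 25 25 * theta p 25 65)
      + p powi 84 * (theta p 25 35 * theta p 25 85)"
    by simp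
  also have "\<dots> = (theta p 25 5)\<^sup>2 - (p powi 22 * p powi (-20)) * (theta p 25 5 * theta p 25 15)
      - (p powi 84 * p powi (-60) * p powi (-10) * p powi (-10)) * (theta p 25 15)\<^sup>2"
  proof -
    \<comment> \<open>This kills the classes d = 1 and d = 3. The classes 0, 2 and 4 give the three
      terms of the quadratic form once the coefficients 45, 85 and 35 are shifted down to 5 and
      15.\<close>
    have "theta p 25 25 = 0"
      using p by (intro theta_eq_0)
    moreover have "theta p 25 45 = - (p powi (- 20)) * theta p 25 5"
      using theta_shift[OF p(1), of 25 45] theta_uminus[of p 25 5] by simp
    moreover have "theta p 25 85 = - (p powi (- 60)) * theta p 25 35"
      using theta_shift[OF p(1), of 25 85] by simp
    moreover have "theta p 25 35 = - (p powi (- 10)) * theta p 25 15"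
      using theta_shift[OF p(1), of 25 35] theta_uminus[of p 25 15] by simp
    ultimately show ?thesis
      by (simp add: theta_uminus power2_eq_square mult_ac del: power_int_numeral power_int_minus)
  qed
  also have "p powi 22 * p powi (-20) = p ^ 2"
    using padd[of 22 "-20"] by simp
  also have "p powi 84 * p powi (-60) * p powi (-10) * p powi (-10) = p ^ 4"
    using padd[of 84 "-60"] padd[of 24 "-10"] padd[of 14 "-10"] by simp
  finally show ?thesis by (simp add: mult_ac)
qed

section \<open>Weighted theta series and the Wronskian\<close>

text \<open>The weight is the linear form from completing the square: (2an + b)^2 = 4a(an^2 + bn) +
  b^2. Hence the second moment is 4a p d/dp + b^2 applied to \<open>theta\<close>, while the weights
  themselves transform linearly under lattice rotations.\<close>

definition theta_moment :: "nat \<Rightarrow> 'a :: {real_normed_field, banach, second_countable_topology} \<Rightarrow> int \<Rightarrow> int \<Rightarrow> 'a" where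
  "theta_moment k p a b = (\<Sum>\<^sub>\<infinity>n. (-1) powi n * of_int (2 * a * n + b) ^ k * p powi (a * n\<^sup>2 + b * n))"

lemma theta_moment_0: "theta_moment 0 p a b = theta p a b"
  by (simp add: theta_moment_def theta_def)

lemma theta_moment_summable:
  fixes p :: "'a :: {real_normed_field, banach, second_countable_topology}"
  assumes "p \<noteq> 0" "norm p < 1" "0 < a"
  shows "(\<lambda>n. norm ((-1) powi n * of_int (2 * a * n + b) ^ k * p powi (a * n\<^sup>2 + b * n))) summable_on UNIV"
proof (rule theta_abs_summable[where K = "of_int (2 * a + \<bar>b\<bar>) ^ k" and k = k])
  fix n :: int
  have "\<bar>2 * a * n + b\<bar> \<le> 2 * a * \<bar>n\<bar> + \<bar>b\<bar>"
    using assms(3) by (intro order.trans[OF abs_triangle_ineq]) (simp add: abs_mult)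
  also have "\<dots> \<le> (2 * a + \<bar>b\<bar>) * (1 + \<bar>n\<bar>)"
    using assms(3) by (simp add: algebra_simps)
  finally have "real_of_int \<bar>2 * a * n + b\<bar> \<le> of_int ((2 * a + \<bar>b\<bar>) * (1 + \<bar>n\<bar>))"
    by (simp only: of_int_le_iff)
  then have "norm (of_int (2 * a * n + b) :: 'a) ^ k \<le> of_int ((2 * a + \<bar>b\<bar>) * (1 + \<bar>n\<bar>)) ^ k"
    by (intro power_mono) (simp_all only: norm_of_int norm_ge_zero of_int_abs)
  then show "norm ((-1) powi n * of_int (2 * a * n + b) ^ k :: 'a) \<le> of_int (2 * a + \<bar>b\<bar>) ^ k * (1 + \<bar>real_of_int n\<bar>) ^ k"
    by (simp only: norm_mult norm_minus_one_powi norm_power mult_1_left of_int_mult of_int_add of_int_abs of_int_1 power_mult_distrib)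
qed (use assms in auto)

lemma has_sum_difference:
  fixes f g :: "'a \<Rightarrow> 'b :: real_normed_vector"
  assumes "(f has_sum x) A" "(g has_sum y) A"
  shows "((\<lambda>z. f z - g z) has_sum (x - y)) A"
  using has_sum_add[OF assms(1), of "\<lambda>z. - g z" "- y"] assms(2) by (simp add: has_sum_uminus)

text \<open>
  The summand \<open>f\<close> below is invariant under the rotation \<open>(U, V) \<mapsto> (V, -U)\<close> with \<open>U = 2s + 1\<close> and \<open>V = 2t + 1\<close>.
  The rotation permutes four of the five residue classes cyclically, and on the fifth one \<open>f\<close> is antisymmetric.
\<close>

lemma theta_wronskian:
  fixes p :: "'a :: {real_normed_field, banach, second_countable_topology}"
  assumes p: "p \<noteq> 0" "norm p < 1"
  shows "theta_moment 2 p 5 3 * theta p 5 1 - theta p 5 3 * theta_moment 2 p 5 1 = 2 * (theta_moment 1 p 1 1)\<^sup>2"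
proof -
  have padd: "p powi (i + j) = p powi i * p powi j" for i j
    using p(1) by (simp add: power_int_add)
  let ?t = "\<lambda>k a b n. (-1) powi n * of_int (2 * a * n + b) ^ k * p powi (a * n\<^sup>2 + b * n)"
  have prod: "((\<lambda>(x, y). ?t k a b x * ?t l c d y) has_sum (theta_moment k p a b * theta_moment l p c d)) UNIV"
    if "0 < a" "0 < c" for k l a b c d
    unfolding theta_moment_def
    by (rule abs_summable_on_Times(2)) (use theta_moment_summable p that in blast)+
  \<comment> \<open>With X + iY = (2 - i)(U + iV), that is X = 2U + V and Y = 2V - U, this form is
    X^2 - Y^2. On the class d = 0 one has X = 10m + 3 and Y = 10n + 1, so that class alone yields
    the Wronskian.\<close>
  let ?F = "\<lambda>u v :: int. 8 * u * v + 3 * (u\<^sup>2 - v\<^sup>2)"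
  define f :: "int \<times> int \<Rightarrow> 'a" where
    "f = (\<lambda>(s, t). (-1) powi (s + t) * of_int (?F (2 * s + 1) (2 * t + 1)) * p powi (s\<^sup>2 + s + t\<^sup>2 + t))"
  define S where "S = (\<lambda>d. \<Sum>\<^sub>\<infinity>(m, n). f (2 * m - n, m + 2 * n + d))"
  have f_eq: "f = (\<lambda>z. 8 * (case z of (x, y) \<Rightarrow> ?t 1 1 1 x * ?t 1 1 1 y) + 
      3 * ((case z of (x, y) \<Rightarrow> ?t 2 1 1 x * ?t 0 1 1 y) - (case z of (x, y) \<Rightarrow> ?t 0 1 1 x * ?t 2 1 1 y)))"
  proof
    fix z :: "int \<times> int"
    obtain s t where z: "z = (s, t)" by (cases z)
    have "f (s, t) = ((-1) powi s * (-1) powi t) * of_int (?F (2 * s + 1) (2 * t + 1)) *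
       (p powi (s\<^sup>2 + s) * p powi (t\<^sup>2 + t))"
      unfolding f_def prod.case by (simp only: padd power_int_add mult_ac) (simp add: power_int_add)
    then show "f z = 8 * (case z of (x, y) \<Rightarrow> ?t 1 1 1 x * ?t 1 1 1 y) + 
      3 * ((case z of (x, y) \<Rightarrow> ?t 2 1 1 x * ?t 0 1 1 y) - (case z of (x, y) \<Rightarrow> ?t 0 1 1 x * ?t 2 1 1 y))"
      unfolding z by (simp add: algebra_simps)
  qed
  \<comment> \<open>Over the whole lattice the part 3(u^2 - v^2) cancels by exchanging the
    coordinates; only the mixed term 8uv survives, as a square.\<close>
  have total: "(f has_sum 8 * (theta_moment 1 p 1 1)\<^sup>2) UNIV"
  proof -
    have "(f has_sum (8 * (theta_moment 1 p 1 1 * theta_moment 1 p 1 1) + 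
       3 * (theta_moment 2 p 1 1 * theta_moment 0 p 1 1 - theta_moment 0 p 1 1 * theta_moment 2 p 1 1))) UNIV"
      unfolding f_eq by (intro has_sum_add has_sum_difference has_sum_cmult_right prod) auto
    then show ?thesis by (simp add: power2_eq_square mult.commute)
  qed
  have rot: "f (t, - s - 1) = f (s, t)" for s t
  proof -
    have "t\<^sup>2 + t + (- s - 1)\<^sup>2 + (- s - 1) = s\<^sup>2 + s + t\<^sup>2 + t"
         "?F (2 * t + 1) (2 * (- s - 1) + 1) = - ?F (2 * s + 1) (2 * t + 1)"
      by (simp_all add: power2_eq_square algebra_simps)
    moreover have "(-1 :: 'a) powi (t + (- s - 1)) = - ((-1) powi (s + t))"
      by (simp add: minus_one_powi)
    ultimately show ?thesis
      unfolding f_def prod.case by (simp only: of_int_minus minus_mult_minus)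
  qed
  \<comment> \<open>The rotation sends class d to -1 - 3d modulo 5, and c brings the result back
    into the range 0 to 4. This gives 0, 4, 2, 3 in turn and fixes class 1.\<close>
  have S_rot: "S d = S (5 * c - 1 - 3 * d)" for c d
    unfolding S_def
  proof (rule infsum_reindex_bij_witness[of _ "\<lambda>(m, n). (d - 2 * c - n, m + c - d)" "\<lambda>(m, n). (n + d - c, d - 2 * c - m)"])
    fix z :: "int \<times> int"
    obtain m n where z: "z = (m, n)" by (cases z)
    have "2 * (n + d - c) - (d - 2 * c - m) = m + 2 * n + d"
      "(n + d - c) + 2 * (d - 2 * c - m) + (5 * c - 1 - 3 * d) = - (2 * m - n) - 1"
      by simp_all
    then show "(case case z of (m, n) \<Rightarrow> (n + d - c, d - 2 * c - m) of (m, n) \<Rightarrow> f (2 * m - n, m + 2 * n + (5 * c - 1 - 3 * d)))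
       = (case z of (m, n) \<Rightarrow> f (2 * m - n, m + 2 * n + d))"
      unfolding z prod.case by (simp only: rot)
  qed auto
  have S4: "S 0 = S 4" and S2: "S 4 = S 2" and S3: "S 2 = S 3"
    using S_rot[of 0 1] S_rot[of 4 3] S_rot[of 2 2] by simp_all
  \<comment> \<open>On class 1, X = 5(2m + 1) and Y = 5(2n + 1), so exchanging m and n negates X^2 -
    Y^2 and preserves the exponent and the sign.\<close>
  have anti: "f (2 * n - m, n + 2 * m + 1) = - f (2 * m - n, m + 2 * n + 1)" for m n
  proof -
    have "(2 * n - m)\<^sup>2 + (2 * n - m) + (n + 2 * m + 1)\<^sup>2 + (n + 2 * m + 1)
         = (2 * m - n)\<^sup>2 + (2 * m - n) + (m + 2 * n + 1)\<^sup>2 + (m + 2 * n + 1)"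
         "?F (2 * (2 * n - m) + 1) (2 * (n + 2 * m + 1) + 1) = - ?F (2 * (2 * m - n) + 1) (2 * (m + 2 * n + 1) + 1)"
      by (simp_all add: power2_eq_square algebra_simps)
    moreover have "(-1 :: 'a) powi ((2 * n - m) + (n + 2 * m + 1)) = (-1) powi ((2 * m - n) + (m + 2 * n + 1))"
      by (simp add: minus_one_powi)
    ultimately show ?thesis
      unfolding f_def prod.case by (simp only: of_int_minus mult_minus_left mult_minus_right)
  qed
  have "S 1 = (\<Sum>\<^sub>\<infinity>(m, n). - f (2 * m - n, m + 2 * n + 1))"
    unfolding S_def
  proof (rule infsum_reindex_bij_witness[of _ prod.swap prod.swap])
    fix z :: "int \<times> int"
    obtain m n where z: "z = (m, n)" by (cases z)
    show "(case prod.swap z of (m, n) \<Rightarrow> - f (2 * m - n, m + 2 * n + 1)) = (case z of (m, n) \<Rightarrow> f (2 * m - n, m + 2 * n + 1))"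
      unfolding z swap_simp prod.case by (simp only: anti[of m n] minus_minus)
  qed auto
  also have "\<dots> = - S 1"
    unfolding S_def by (simp add: case_prod_unfold infsum_uminus)
  finally have "2 * S 1 = 0"
    by (simp only: mult_2 eq_neg_iff_add_eq_0)
  then have S1: "S 1 = 0" by simp
  have "8 * (theta_moment 1 p 1 1)\<^sup>2 = (\<Sum>d\<in>{0..<5}. S d)"
    using infsum_lattice5[of f] total unfolding S_def by (simp add: has_sum_iff)
  also have "{0..<5::int} = {0, 1, 2, 3, 4}" by auto
  also have "(\<Sum>d\<in>\<dots>. S d) = 4 * S 0"
    using S1 S2 S3 S4 by simp
  also have "S 0 = (\<Sum>\<^sub>\<infinity>z. (case z of (x, y) \<Rightarrow> ?t 2 5 3 x * ?t 0 5 1 y) - (case z of (x, y) \<Rightarrow> ?t 0 5 3 x * ?t 2 5 1 y))"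
    unfolding S_def
  proof (rule infsum_cong)
    fix z :: "int \<times> int"
    obtain m n where z: "z = (m, n)" by (cases z)
    have e: "(2 * m - n)\<^sup>2 + (2 * m - n) + (m + 2 * n + 0)\<^sup>2 + (m + 2 * n + 0) = (5 * m\<^sup>2 + 3 * m) + (5 * n\<^sup>2 + 1 * n)"
       "?F (2 * (2 * m - n) + 1) (2 * (m + 2 * n + 0) + 1) = (2 * 5 * m + 3)\<^sup>2 - (2 * 5 * n + 1)\<^sup>2"
      by (simp_all add: power2_eq_square algebra_simps)
    have s: "(-1 :: 'a) powi ((2 * m - n) + (m + 2 * n + 0)) = (-1) powi m * (-1) powi n"
      by (simp add: minus_one_powi)
    show "(case z of (m, n) \<Rightarrow> f (2 * m - n, m + 2 * n + 0)) = (case z of (x, y) \<Rightarrow> ?t 2 5 3 x * ?t 0 5 1 y) - (case z of (x, y) \<Rightarrow> ?t 0 5 3 x * ?t 2 5 1 y)"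
      unfolding z f_def prod.case e s padd[of "5 * m\<^sup>2 + 3 * m" "5 * n\<^sup>2 + 1 * n"] of_int_diff of_int_power
      by (simp only: ring_distribs mult_ac power_0 mult_1_left mult_1_right)
  qed
  also have "\<dots> = theta_moment 2 p 5 3 * theta_moment 0 p 5 1 - theta_moment 0 p 5 3 * theta_moment 2 p 5 1"
    by (intro infsumI has_sum_difference prod) auto
  finally have "4 * (2 * (theta_moment 1 p 1 1)\<^sup>2) = 
      4 * (theta_moment 2 p 5 3 * theta p 5 1 - theta p 5 3 * theta_moment 2 p 5 1)"
    by (simp add: theta_moment_0)
  then show ?thesis
    by (subst (asm) mult_cancel_left) simp
qed

section \<open>The Jacobi triple product\<close>

definition qpoch :: "'a :: comm_ring_1 \<Rightarrow> nat \<Rightarrow> 'a" where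
  "qpoch q n = (\<Prod>i<n. 1 - q ^ Suc i)"

text \<open>This is f(-q), stated over any complete normed field so that it can be evaluated at
  complex multiples of q.\<close>

definition euler_phi :: "'a :: {real_normed_field, banach} \<Rightarrow> 'a" where
  "euler_phi q = (\<Prod>n. 1 - q ^ Suc n)"

definition qbinom :: "'a :: field \<Rightarrow> nat \<Rightarrow> nat \<Rightarrow> 'a" where
  "qbinom q n k = (if k \<le> n then qpoch q n / (qpoch q k * qpoch q (n - k)) else 0)"

lemma qpoch_0 [simp]: "qpoch q 0 = 1"
  by (simp add: qpoch_def)

lemma qpoch_Suc: "qpoch q (Suc n) = qpoch q n * (1 - q ^ Suc n)"
  by (simp add: qpoch_def)

lemma one_minus_power_nonzero:
  fixes q :: "'a :: real_normed_field"
  assumes "norm q < 1"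
  shows "1 - q ^ Suc n \<noteq> 0"
proof
  assume "1 - q ^ Suc n = 0"
  then have "norm q ^ Suc n = 1"
    by (metis eq_iff_diff_eq_0 norm_one norm_power)
  moreover have "norm q ^ Suc n < 1"
    using assms by (subst power_less_one_iff) auto
  ultimately show False by simp
qed

lemma qpoch_nonzero:
  fixes q :: "'a :: real_normed_field"
  assumes "norm q < 1"
  shows "qpoch q n \<noteq> 0"
  unfolding qpoch_def using one_minus_power_nonzero[OF assms] by (simp del: power_Suc)

lemma convergent_prod_one_minus_geometric:
  fixes q z :: "'a :: {real_normed_field, banach}"
  assumes "norm q < 1"
  shows "convergent_prod (\<lambda>i. 1 - z * q ^ i)"
proof (rule abs_convergent_prod_imp_convergent_prod)
  show "abs_convergent_prod (\<lambda>i. 1 - z * q ^ i)"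
    unfolding abs_convergent_prod_conv_summable
    using assms by (simp add: norm_mult norm_power summable_mult)
qed

lemma euler_phi_convergent_prod:
  fixes q :: "'a :: {real_normed_field, banach}"
  assumes "norm q < 1"
  shows "convergent_prod (\<lambda>n. 1 - q ^ Suc n)"
  using convergent_prod_one_minus_geometric[OF assms, of q] by simp

lemma qpoch_tendsto:
  fixes q :: "'a :: {real_normed_field, banach}"
  assumes "norm q < 1"
  shows "qpoch q \<longlonglongrightarrow> euler_phi q"
proof -
  have "(\<lambda>n. qpoch q (Suc n)) \<longlonglongrightarrow> euler_phi q"
    using convergent_prod_LIMSEQ[OF euler_phi_convergent_prod[OF assms]]
    unfolding qpoch_def euler_phi_def lessThan_Suc_atMost .
  then show ?thesis by (rule LIMSEQ_imp_Suc)
qed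

lemma euler_phi_nonzero:
  fixes q :: "'a :: {real_normed_field, banach}"
  assumes "norm q < 1"
  shows "euler_phi q \<noteq> 0"
  unfolding euler_phi_def
  using prodinf_nonzero[OF euler_phi_convergent_prod[OF assms]] one_minus_power_nonzero[OF assms] by blast

lemma qpoch_bounded:
  fixes q :: "'a :: {real_normed_field, banach}"
  assumes "norm q < 1"
  obtains K where "K > 0" "\<And>n. norm (qpoch q n) \<le> K" "\<And>n. norm (inverse (qpoch q n)) \<le> K"
proof -
  have "Bseq (qpoch q)"
    using qpoch_tendsto[OF assms] by (meson convergentI convergent_imp_Bseq)
  then obtain K1 where K1: "K1 > 0" "\<And>n. norm (qpoch q n) \<le> K1"
    unfolding Bseq_def by blast
  have "(\<lambda>n. inverse (qpoch q n)) \<longlonglongrightarrow> inverse (euler_phi q)"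
    by (intro tendsto_inverse qpoch_tendsto assms euler_phi_nonzero)
  then have "Bseq (\<lambda>n. inverse (qpoch q n))"
    by (meson convergentI convergent_imp_Bseq)
  then obtain K2 where K2: "K2 > 0" "\<And>n. norm (inverse (qpoch q n)) \<le> K2"
    unfolding Bseq_def by blast
  show ?thesis
    by (rule that[of "max K1 K2"]) (use K1 K2 in \<open>auto simp: le_max_iff_disj\<close>)
qed

lemma qbinom_0 [simp]:
  fixes q :: "'a :: real_normed_field"
  assumes "norm q < 1"
  shows "qbinom q n 0 = 1" "qbinom q n n = 1"
  using qpoch_nonzero[OF assms] by (auto simp: qbinom_def)

text \<open>The q-Pascal rule comes from splitting 1 - q^(n+1) as (1 - q^(n-k)) + q^(n-k) (1 -
  q^(k+1)), each piece cancelling one denominator factor. For k = n the first piece is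
  absent.\<close>

lemma qbinom_Suc:
  fixes q :: "'a :: real_normed_field"
  assumes "norm q < 1" "k \<le> n"
  shows "qbinom q (Suc n) (Suc k) = qbinom q n (Suc k) + q ^ (n - k) * qbinom q n k"
proof (cases "k = n")
  case True
  then show ?thesis using assms by (simp add: qbinom_def qpoch_nonzero)
next
  case False
  then obtain j where n: "n = k + Suc j"
    using assms(2) by (metis add_Suc_right le_neq_implies_less less_imp_Suc_add)
  have nz: "qpoch q i \<noteq> 0" "1 - q ^ Suc i \<noteq> 0" for i
    using assms qpoch_nonzero one_minus_power_nonzero by blast+
  have "1 - q ^ Suc n = (1 - q ^ Suc j) + q ^ Suc j * (1 - q ^ Suc k)"
    unfolding n by (simp add: algebra_simps power_add)
  then have "qbinom q (Suc n) (Suc k) = qpoch q n * ((1 - q ^ Suc j) + q ^ Suc j * (1 - q ^ Suc k)) /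
      ((qpoch q k * (1 - q ^ Suc k)) * (qpoch q j * (1 - q ^ Suc j)))"
    unfolding qbinom_def qpoch_Suc[of q n] qpoch_Suc[of q k] by (simp add: n qpoch_Suc[of q j] del: power_Suc)
  also have "\<dots> = qpoch q n / ((qpoch q k * (1 - q ^ Suc k)) * qpoch q j) + 
      q ^ Suc j * (qpoch q n / (qpoch q k * (qpoch q j * (1 - q ^ Suc j))))"
  proof -
    have "A * (x + y * z) / ((P * z) * (Q * x)) = A / ((P * z) * Q) + y * (A / (P * (Q * x)))"
      if "x \<noteq> 0" "z \<noteq> 0" "P \<noteq> 0" "Q \<noteq> 0" for A x y z P Q :: 'a
      using that by (simp add: field_simps)
    then show ?thesis using nz by blast
  qed
  also have "\<dots> = qbinom q n (Suc k) + q ^ (n - k) * qbinom q n k"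
    unfolding qbinom_def qpoch_Suc[symmetric] by (simp add: n del: power_Suc)
  finally show ?thesis .
qed

text \<open>Here and below, \<open>p\<close> is a square root of the base, so that \<open>p ^ (k\<^sup>2 - k)\<close> is the usual \<open>q ^ (k choose 2)\<close>.\<close>

lemma qbinomial_theorem:
  fixes p x :: "'a :: real_normed_field"
  assumes "norm p < 1"
  shows "(\<Prod>i<n. 1 + x * p ^ (2 * i)) = (\<Sum>k\<le>n. qbinom (p\<^sup>2) n k * p ^ (k * (k - 1)) * x ^ k)"
proof (induction n)
  case 0
  then show ?case by (simp add: qbinom_def)
next
  case (Suc n)
  have q: "norm (p\<^sup>2) < 1"
    using assms by (simp add: norm_power power_less_one_iff)
  let ?B = "qbinom (p\<^sup>2)"
  have "(\<Sum>k\<le>Suc n. ?B (Suc n) k * p ^ (k * (k - 1)) * x ^ k)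
      = 1 + (\<Sum>k\<le>n. ?B (Suc n) (Suc k) * p ^ (Suc k * k) * x ^ Suc k)"
    using q by (subst sum.atMost_Suc_shift) simp
  also have "(\<Sum>k\<le>n. ?B (Suc n) (Suc k) * p ^ (Suc k * k) * x ^ Suc k)
     = (\<Sum>k\<le>n. ?B n (Suc k) * p ^ (Suc k * k) * x ^ Suc k 
          + x * p ^ (2 * n) * (?B n k * p ^ (k * (k - 1)) * x ^ k))"
  proof (rule sum.cong)
    fix k assume k: "k \<in> {..n}"
    have "2 * (n - k) + Suc k * k = 2 * n + k * (k - 1)"
      using k by (cases k) auto
    then have "p\<^sup>2 ^ (n - k) * p ^ (Suc k * k) = p ^ (2 * n) * p ^ (k * (k - 1))"
      by (metis power_add power_mult)
    then show "?B (Suc n) (Suc k) * p ^ (Suc k * k) * x ^ Suc k =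
       ?B n (Suc k) * p ^ (Suc k * k) * x ^ Suc k + x * p ^ (2 * n) * (?B n k * p ^ (k * (k - 1)) * x ^ k)"
      using k q by (simp add: qbinom_Suc algebra_simps)
  qed simp
  also have "1 + \<dots> = (1 + (\<Sum>k\<le>n. ?B n (Suc k) * p ^ (Suc k * k) * x ^ Suc k))
      + x * p ^ (2 * n) * (\<Sum>k\<le>n. ?B n k * p ^ (k * (k - 1)) * x ^ k)"
    by (simp add: sum.distrib sum_distrib_left)
  also have "1 + (\<Sum>k\<le>n. ?B n (Suc k) * p ^ (Suc k * k) * x ^ Suc k) = 
      (\<Sum>k\<le>Suc n. ?B n k * p ^ (k * (k - 1)) * x ^ k)"
    using q by (subst sum.atMost_Suc_shift) simp
  also have "\<dots> = (\<Sum>k\<le>n. ?B n k * p ^ (k * (k - 1)) * x ^ k)"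
    by (simp add: qbinom_def)
  finally show ?case
    using Suc.IH by (simp add: algebra_simps)
qed

lemma prod_lessThan_add:
  fixes f :: "nat \<Rightarrow> 'a :: comm_monoid_mult"
  shows "(\<Prod>i<m + n. f i) = (\<Prod>i<m. f i) * (\<Prod>i<n. f (m + i))"
  by (induction n) (simp_all add: mult_ac)

text \<open>The q-binomial theorem with 2N factors, centred by x = -z q^(-N) where q = p^2. The
  upper half of the factors is the first product; in the lower half, 1 - z q^(-i) = -z q^(-i) (1 -
  q^i / z) produces the second product and the monomial \<open>c\<close>, which cancels against the
  centred sum.\<close>

lemma finite_jacobi_triple_product:
  fixes p z :: "'a :: real_normed_field"
  assumes p: "p \<noteq> 0" "norm p < 1" and z: "z \<noteq> 0"
  shows "(\<Prod>i<N. 1 - z * p\<^sup>2 ^ i) * (\<Prod>i<N. 1 - p\<^sup>2 ^ Suc i / z) =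
         (\<Sum>n\<in>{- int N..int N}. (-1) powi n * z powi n * p powi (n\<^sup>2 - n) * qbinom (p\<^sup>2) (2 * N) (nat (int N + n)))"
proof -
  have padd: "p powi (i + j) = p powi i * p powi j" for i j
    using p(1) by (simp add: power_int_add)
  define c where "c = (\<Prod>i<N. - z * p powi (- 2 * int (Suc i)))"
  have c: "c = (- z) ^ N * p powi (- (int N * (int N + 1)))"
    unfolding c_def
  proof (induction N)
    case (Suc N)
    have e: "- (int (Suc N) * (int (Suc N) + 1)) = - (int N * (int N + 1)) + (- 2 * int (Suc N))"
      by (simp add: algebra_simps)
    show ?case unfolding e padd prod.lessThan_Suc Suc by (simp only: power_Suc mult_ac)
  qed simp
  have "c \<noteq> 0" unfolding c using p z by simp
  let ?x = "- z * p powi (- 2 * int N)"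
  have "(\<Prod>i<2 * N. 1 + ?x * p ^ (2 * i)) = (\<Prod>i<N. 1 + ?x * p ^ (2 * i)) * (\<Prod>i<N. 1 + ?x * p ^ (2 * (N + i)))"
    by (simp only: mult_2[of N] prod_lessThan_add)
  also have "(\<Prod>i<N. 1 + ?x * p ^ (2 * (N + i))) = (\<Prod>i<N. 1 - z * p\<^sup>2 ^ i)"
  proof (rule prod.cong)
    fix i
    have "p powi (- 2 * int N) * p ^ (2 * (N + i)) = p powi (- 2 * int N + int (2 * (N + i)))"
      by (simp only: padd power_int_of_nat)
    also have "- 2 * int N + int (2 * (N + i)) = int (2 * i)" by simp
    also have "p powi int (2 * i) = p\<^sup>2 ^ i" by (simp only: power_int_of_nat power_mult)
    finally have 1: "p powi (- 2 * int N) * p ^ (2 * (N + i)) = p\<^sup>2 ^ i" .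
    show "1 + ?x * p ^ (2 * (N + i)) = 1 - z * p\<^sup>2 ^ i"
      unfolding 1[symmetric] by simp
  qed simp
  also have "(\<Prod>i<N. 1 + ?x * p ^ (2 * i)) = (\<Prod>i<N. 1 + ?x * p ^ (2 * (N - Suc i)))"
    by (rule prod.nat_diff_reindex[symmetric])
  also have "\<dots> = (\<Prod>i<N. (- z * p powi (- 2 * int (Suc i))) * (1 - p\<^sup>2 ^ Suc i / z))"
  proof (rule prod.cong)
    fix i assume "i \<in> {..<N}"
    then have e: "- 2 * int N + int (2 * (N - Suc i)) = - 2 * int (Suc i)" by auto
    have "p powi (- 2 * int N) * p ^ (2 * (N - Suc i)) = p powi (- 2 * int N + int (2 * (N - Suc i)))"
      by (simp only: padd power_int_of_nat)
    also have "\<dots> = p powi (- 2 * int (Suc i))" unfolding e ..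
    finally have 1: "p powi (- 2 * int N) * p ^ (2 * (N - Suc i)) = p powi (- 2 * int (Suc i))" .
    have "p powi (- 2 * int (Suc i)) * p\<^sup>2 ^ Suc i = p powi (- 2 * int (Suc i) + int (2 * Suc i))"
      unfolding padd by (simp only: power_int_of_nat power_mult)
    then have 2: "p powi (- 2 * int (Suc i)) * p\<^sup>2 ^ Suc i = 1" by simp
    have "1 + ?x * p ^ (2 * (N - Suc i)) = 1 - z * p powi (- 2 * int (Suc i))"
      unfolding 1[symmetric] by simp
    also have "\<dots> = (- z * p powi (- 2 * int (Suc i))) * (1 - p\<^sup>2 ^ Suc i / z)"
      using z 2 by (simp add: right_diff_distrib del: power_Suc mult_minus_left of_nat_Suc)
    finally show "1 + ?x * p ^ (2 * (N - Suc i)) = \<dots>" .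
  qed simp
  also have "\<dots> = c * (\<Prod>i<N. 1 - p\<^sup>2 ^ Suc i / z)"
    unfolding c_def by (rule prod.distrib)
  finally have "c * ((\<Prod>i<N. 1 - z * p\<^sup>2 ^ i) * (\<Prod>i<N. 1 - p\<^sup>2 ^ Suc i / z)) = (\<Prod>i<2 * N. 1 + ?x * p ^ (2 * i))"
    by (simp only: mult_ac)
  also have "\<dots> = (\<Sum>k\<le>2 * N. qbinom (p\<^sup>2) (2 * N) k * p ^ (k * (k - 1)) * ?x ^ k)"
    using p(2) by (rule qbinomial_theorem)
  also have "\<dots> = (\<Sum>n\<in>{- int N..int N}. c * ((-1) powi n * z powi n * p powi (n\<^sup>2 - n) * qbinom (p\<^sup>2) (2 * N) (nat (int N + n))))"
  proof (rule sum.reindex_bij_witness[of _ "\<lambda>n. nat (int N + n)" "\<lambda>k. int k - int N"])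
    fix k assume k: "k \<in> {..2 * N}"
    let ?n = "int k - int N"
    have e: "- (int N * (int N + 1)) + (?n\<^sup>2 - ?n) = int (k * (k - 1)) + (- 2 * int N * int k)"
      by (cases k) (simp_all add: power2_eq_square algebra_simps)
    have "c * ((-1) powi ?n * z powi ?n * p powi (?n\<^sup>2 - ?n)) 
       = ((- z) powi int N * (- z) powi ?n) * (p powi (- (int N * (int N + 1))) * p powi (?n\<^sup>2 - ?n))"
      unfolding c by (simp flip: power_int_mult_distrib)
    also have "(- z) powi int N * (- z) powi ?n = (- z) powi int k"
      using z by (subst power_int_add[symmetric]) auto
    also have "p powi (- (int N * (int N + 1))) * p powi (?n\<^sup>2 - ?n) = p ^ (k * (k - 1)) * p powi (- 2 * int N * int k)"
      unfolding padd[symmetric] e by (simp only: padd power_int_of_nat)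
    also have "(- z) powi int k * (p ^ (k * (k - 1)) * p powi (- 2 * int N * int k)) = p ^ (k * (k - 1)) * ?x ^ k"
      by (simp only: power_mult_distrib power_int_of_nat power_int_power' mult_ac)
    finally have "p ^ (k * (k - 1)) * ?x ^ k = c * ((-1) powi ?n * z powi ?n * p powi (?n\<^sup>2 - ?n))" ..
    then show "c * ((-1) powi ?n * z powi ?n * p powi (?n\<^sup>2 - ?n) * qbinom (p\<^sup>2) (2 * N) (nat (int N + ?n)))
       = qbinom (p\<^sup>2) (2 * N) k * p ^ (k * (k - 1)) * ?x ^ k"
      by (simp add: mult_ac)
  qed auto
  finally show ?thesis
    using \<open>c \<noteq> 0\<close> by (simp flip: sum_distrib_left)
qed

section \<open>Passage to the limit in the triple product\<close>

text \<open>The enumeration \<open>int_decode\<close> reduces dominated convergence of bilateral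
  sums to series over the naturals; absolute convergence makes the order of summation
  irrelevant.\<close>

lemma tannery_int:
  fixes f :: "nat \<Rightarrow> int \<Rightarrow> 'a :: {real_normed_field, banach}"
  assumes lim: "\<And>n. (\<lambda>N. f N n) \<longlonglongrightarrow> g n"
    and bound: "\<And>N n. norm (f N n) \<le> M n" and M: "M summable_on UNIV"
  shows "(\<lambda>N. \<Sum>\<^sub>\<infinity>n. f N n) \<longlonglongrightarrow> (\<Sum>\<^sub>\<infinity>n. g n)"
proof -
  have "norm (f 0 n) \<le> M n" for n by (rule bound)
  then have M_nonneg: "0 \<le> M n" for n
    using norm_ge_zero order.trans by blast
  have conv: "infsum h UNIV = (\<Sum>k. h (int_decode k))" if "\<And>n. norm (h n) \<le> M n" for h :: "int \<Rightarrow> 'a"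
  proof -
    have "(\<lambda>n. norm (h n)) summable_on UNIV"
      by (rule summable_on_comparison_test[OF M]) (use that in auto)
    then have "h summable_on UNIV" by (rule abs_summable_summable)
    then have "(h has_sum infsum h UNIV) UNIV" by simp
    then have "((\<lambda>k. h (int_decode k)) has_sum infsum h UNIV) UNIV"
      by (subst has_sum_reindex_bij_betw[OF bij_int_decode])
    from has_sum_imp_sums[OF this] show ?thesis by (simp add: sums_iff)
  qed
  have "((\<lambda>k. M (int_decode k)) has_sum infsum M UNIV) UNIV"
    using M by (subst has_sum_reindex_bij_betw[OF bij_int_decode]) simp
  from has_sum_imp_sums[OF this] have sM: "summable (\<lambda>k. M (int_decode k))"
    by (simp add: sums_iff)
  have g: "norm (g n) \<le> M n" for n
    by (rule tendsto_upperbound[OF tendsto_norm[OF lim]]) (auto simp: bound)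
  have "(\<lambda>N. \<Sum>k. f N (int_decode k)) \<longlonglongrightarrow> (\<Sum>k. g (int_decode k))"
    using tannerys_theorem[of "\<lambda>k N. f N (int_decode k)" "\<lambda>k. g (int_decode k)" sequentially "\<lambda>k. M (int_decode k)"]
    by (simp add: lim bound sM case_prod_unfold)
  then show ?thesis
    by (simp add: conv[OF bound] conv[OF g])
qed

text \<open>Both \<open>qpoch q n\<close> and its reciprocal converge, hence are bounded. Uniformity
  in both indices supplies the dominating series for the limit of the finite triple product.\<close>

lemma qbinom_bounded:
  fixes q :: "'a :: {real_normed_field, banach}"
  assumes "norm q < 1"
  obtains K where "\<And>n k. norm (qbinom q n k) \<le> K"
proof -
  obtain L where L: "L > 0" "\<And>n. norm (qpoch q n) \<le> L" "\<And>n. norm (inverse (qpoch q n)) \<le> L"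
    using qpoch_bounded[OF assms] by blast
  have "norm (qpoch q n * (inverse (qpoch q k) * inverse (qpoch q m))) \<le> L * (L * L)" for n k m
    unfolding norm_mult using L by (intro mult_mono) auto
  then show ?thesis
    using that[of "L * (L * L)"] L(1) by (simp add: qbinom_def divide_inverse)
qed

lemma central_qbinom_tendsto:
  fixes q :: "'a :: {real_normed_field, banach}"
  assumes "norm q < 1"
  shows "(\<lambda>N. if n \<in> {- int N..int N} then qbinom q (2 * N) (nat (int N + n)) else 0) \<longlonglongrightarrow> inverse (euler_phi q)"
proof (rule Lim_transform_eventually)
  have lim: "filterlim (\<lambda>N. nat (int N + m)) at_top sequentially" for m
    unfolding filterlim_at_top
  proof
    fix Z :: nat
    show "\<forall>\<^sub>F N in sequentially. Z \<le> nat (int N + m)"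
      using eventually_ge_at_top[of "nat (int Z - m)"] by eventually_elim linarith
  qed
  have lim2: "filterlim (\<lambda>N :: nat. 2 * N) at_top sequentially"
    by (rule filterlim_subseq) (simp add: strict_mono_def)
  have "(\<lambda>N. qpoch q (2 * N) / (qpoch q (nat (int N + n)) * qpoch q (nat (int N + - n))))
      \<longlonglongrightarrow> euler_phi q / (euler_phi q * euler_phi q)"
    by (intro tendsto_divide tendsto_mult filterlim_compose[OF qpoch_tendsto[OF assms] lim] 
        filterlim_compose[OF qpoch_tendsto[OF assms] lim2])
       (use euler_phi_nonzero[OF assms] in auto)
  then show "(\<lambda>N. qpoch q (2 * N) / (qpoch q (nat (int N + n)) * qpoch q (nat (int N + - n)))) \<longlonglongrightarrow> inverse (euler_phi q)"
    using euler_phi_nonzero[OF assms] by (simp add: field_simps)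
  show "\<forall>\<^sub>F N in sequentially. qpoch q (2 * N) / (qpoch q (nat (int N + n)) * qpoch q (nat (int N + - n))) = 
     (if n \<in> {- int N..int N} then qbinom q (2 * N) (nat (int N + n)) else 0)"
    using eventually_ge_at_top[of "nat \<bar>n\<bar>"]
  proof eventually_elim
    case (elim N)
    then have "n \<in> {- int N..int N}" "nat (int N + n) \<le> 2 * N" "2 * N - nat (int N + n) = nat (int N + - n)" by auto
    then show ?case by (simp add: qbinom_def)
  qed
qed

lemma central_qbinom_sum_tendsto:
  fixes q :: "'a :: {real_normed_field, banach}"
  assumes q: "norm q < 1" and sm: "(\<lambda>n. norm (c n)) summable_on UNIV"
  shows "(\<lambda>N. \<Sum>n\<in>{- int N..int N}. c n * qbinom q (2 * N) (nat (int N + n)))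
           \<longlonglongrightarrow> (\<Sum>\<^sub>\<infinity>n. c n) / euler_phi q"
proof -
  obtain K where K: "\<And>n k. norm (qbinom q n k) \<le> K"
    using qbinom_bounded[OF q] by blast
  then have "K \<ge> 0" using norm_ge_zero order.trans by blast
  let ?b = "\<lambda>N n. if n \<in> {- int N..int N} then qbinom q (2 * N) (nat (int N + n)) else 0"
  have "(\<lambda>N. \<Sum>\<^sub>\<infinity>n. c n * ?b N n) \<longlonglongrightarrow> (\<Sum>\<^sub>\<infinity>n. c n * inverse (euler_phi q))"
  proof (rule tannery_int)
    show "(\<lambda>N. c n * ?b N n) \<longlonglongrightarrow> c n * inverse (euler_phi q)" for n
      by (intro tendsto_mult tendsto_const central_qbinom_tendsto q)
    show "norm (c n * ?b N n) \<le> norm (c n) * K" for N n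
      unfolding norm_mult using K \<open>K \<ge> 0\<close> by (intro mult_left_mono) auto
    show "(\<lambda>n. norm (c n) * K) summable_on UNIV"
      using sm by (rule summable_on_cmult_left)
  qed
  moreover have "(\<Sum>\<^sub>\<infinity>n. c n * ?b N n) = (\<Sum>n\<in>{- int N..int N}. c n * qbinom q (2 * N) (nat (int N + n)))" for N
  proof -
    have "(\<Sum>\<^sub>\<infinity>n. c n * ?b N n) = (\<Sum>\<^sub>\<infinity>n\<in>{- int N..int N}. c n * qbinom q (2 * N) (nat (int N + n)))"
      by (rule infsum_cong_neutral) auto
    then show ?thesis by simp
  qed
  ultimately show ?thesis
    by (simp add: infsum_cmult_left' divide_inverse)
qed

lemma norm_power2_less_1:
  fixes p :: "'a :: real_normed_field"
  assumes "norm p < 1"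
  shows "norm (p\<^sup>2) < 1"
  using assms by (simp add: norm_power power_less_one_iff)

lemma jacobi_triple_product:
  fixes p z :: "'a :: {real_normed_field, banach}"
  assumes p: "p \<noteq> 0" "norm p < 1" and z: "z \<noteq> 0"
    and sm: "(\<lambda>n. norm ((-1) powi n * z powi n * p powi (n\<^sup>2 - n))) summable_on UNIV"
  shows "(\<lambda>N. (\<Prod>i<N. 1 - z * p\<^sup>2 ^ i) * (\<Prod>i<N. 1 - p\<^sup>2 ^ Suc i / z))
           \<longlonglongrightarrow> (\<Sum>\<^sub>\<infinity>n. (-1) powi n * z powi n * p powi (n\<^sup>2 - n)) / euler_phi (p\<^sup>2)"
  unfolding finite_jacobi_triple_product[OF p z]
  by (rule central_qbinom_sum_tendsto[OF norm_power2_less_1[OF p(2)] sm])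

text \<open>The factors are sorted by their exponent modulo 5. Residues 3 and 2, and 4 and 1, are
  paired because they form the triple products at z = q^3 and z = q^4 in base q^5.\<close>

lemma qpoch_5_times:
  "qpoch q (5 * N) = ((\<Prod>i<N. 1 - q ^ (5 * i + 3)) * (\<Prod>i<N. 1 - q ^ (5 * i + 2)))
     * ((\<Prod>i<N. 1 - q ^ (5 * i + 4)) * (\<Prod>i<N. 1 - q ^ (5 * i + 1))) * qpoch (q ^ 5) N"
proof (induction N)
  case (Suc N)
  have e: "5 * Suc N = Suc (Suc (Suc (Suc (Suc (5 * N)))))" by simp
  have e': "(q ^ 5) ^ Suc N = q ^ (5 * N + 5)"
    unfolding power_mult[symmetric] by (simp add: add.commute)
  show ?case
    unfolding e qpoch_Suc Suc prod.lessThan_Suc e' by (simp add: mult_ac eval_nat_numeral del: power_Suc)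
qed simp

text \<open>Base q^5 and z = q^j with q = p^2 give the exponent 2jn + 5(n^2 - n); j = 3 yields the
  coefficient 1 and j = 4 the coefficient 3.\<close>

lemma theta_eq_triple_product:
  fixes p :: "'a :: {real_normed_field, banach, second_countable_topology}"
  assumes "p \<noteq> 0"
  shows "theta p 5 (2 * int j - 5) = (\<Sum>\<^sub>\<infinity>n. (-1) powi n * ((p\<^sup>2) ^ j) powi n * (p ^ 5) powi (n\<^sup>2 - n))"
    and "(-1) powi n * ((p\<^sup>2) ^ j) powi n * (p ^ 5) powi (n\<^sup>2 - n) = (-1) powi n * p powi (5 * n\<^sup>2 + (2 * int j - 5) * n)"
proof -
  show eq: "(-1) powi n * ((p\<^sup>2) ^ j) powi n * (p ^ 5) powi (n\<^sup>2 - n) = (-1) powi n * p powi (5 * n\<^sup>2 + (2 * int j - 5) * n)" for n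
  proof -
    have "((p\<^sup>2) ^ j) powi n * (p ^ 5) powi (n\<^sup>2 - n) = p powi (int (2 * j) * n) * p powi (int 5 * (n\<^sup>2 - n))"
      by (simp only: power_int_power flip: power_mult)
    also have "\<dots> = p powi (int (2 * j) * n + int 5 * (n\<^sup>2 - n))"
      using assms by (intro power_int_add[symmetric]) auto
    also have "int (2 * j) * n + int 5 * (n\<^sup>2 - n) = 5 * n\<^sup>2 + (2 * int j - 5) * n"
      by (simp add: algebra_simps)
    finally show ?thesis by (simp only: mult.assoc)
  qed
  show "theta p 5 (2 * int j - 5) = (\<Sum>\<^sub>\<infinity>n. (-1) powi n * ((p\<^sup>2) ^ j) powi n * (p ^ 5) powi (n\<^sup>2 - n))"
    unfolding theta_def eq ..
qed

text \<open>The two triple products, each equal to a theta series divided by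
  \<open>euler_phi (q ^ 5)\<close>, together contain every factor of \<open>euler_phi q\<close> with
  exponent prime to 5; the remaining factors form one more \<open>euler_phi (q ^ 5)\<close>.\<close>

lemma theta_product_eq_euler_phi:
  fixes p :: "'a :: {real_normed_field, banach, second_countable_topology}"
  assumes p: "p \<noteq> 0" "norm p < 1"
  shows "theta p 5 1 * theta p 5 3 = euler_phi (p\<^sup>2) * euler_phi (p ^ 10)"
proof -
  define q where "q = p\<^sup>2"
  have q: "norm q < 1" "q \<noteq> 0" unfolding q_def using p by (auto intro: norm_power2_less_1)
  have p5: "p ^ 5 \<noteq> 0" "norm (p ^ 5) < 1" "(p ^ 5)\<^sup>2 = q ^ 5" "norm (q ^ 5) < 1"
    using p q by (auto simp: q_def norm_power power_less_one_iff simp flip: power_mult)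
  have lim: "(\<lambda>N. (\<Prod>i<N. 1 - q ^ (5 * i + j)) * (\<Prod>i<N. 1 - q ^ (5 * i + (5 - j))))
           \<longlonglongrightarrow> theta p 5 (2 * int j - 5) / euler_phi (q ^ 5)" if "j \<le> 5" for j
  proof -
    have "(\<lambda>N. (\<Prod>i<N. 1 - q ^ j * (p ^ 5)\<^sup>2 ^ i) * (\<Prod>i<N. 1 - (p ^ 5)\<^sup>2 ^ Suc i / q ^ j))
      \<longlonglongrightarrow> (\<Sum>\<^sub>\<infinity>n. (-1) powi n * (q ^ j) powi n * (p ^ 5) powi (n\<^sup>2 - n)) / euler_phi ((p ^ 5)\<^sup>2)"
      using theta_summable[OF p, of 5 "2 * int j - 5"] q
      by (intro jacobi_triple_product p5) 
         (simp_all add: q_def theta_eq_triple_product(2)[OF p(1)])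
    also have "(\<lambda>N. (\<Prod>i<N. 1 - q ^ j * (p ^ 5)\<^sup>2 ^ i) * (\<Prod>i<N. 1 - (p ^ 5)\<^sup>2 ^ Suc i / q ^ j))
       = (\<lambda>N. (\<Prod>i<N. 1 - q ^ (5 * i + j)) * (\<Prod>i<N. 1 - q ^ (5 * i + (5 - j))))"
    proof -
      have "q ^ j * (p ^ 5)\<^sup>2 ^ i = q ^ (5 * i + j)" for i
        unfolding p5(3) by (simp add: power_add power_mult)
      moreover have "(p ^ 5)\<^sup>2 ^ Suc i / q ^ j = q ^ (5 * i + (5 - j))" for i
      proof -
        have "(p ^ 5)\<^sup>2 ^ Suc i = q ^ (5 * i + (5 - j)) * q ^ j"
          unfolding p5(3) unfolding power_mult[symmetric] power_add[symmetric] using that by (simp add: add.commute)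
        then show ?thesis using q by simp
      qed
      ultimately show ?thesis by simp
    qed
    finally show ?thesis
      unfolding theta_eq_triple_product(1)[OF p(1)] p5(3) q_def .
  qed
  have "(\<lambda>N. qpoch q (5 * N)) \<longlonglongrightarrow> 
      (theta p 5 (2 * int 3 - 5) / euler_phi (q ^ 5)) * (theta p 5 (2 * int 4 - 5) / euler_phi (q ^ 5)) * euler_phi (q ^ 5)"
    unfolding qpoch_5_times using lim[of 3] lim[of 4]
    by (intro tendsto_mult[OF tendsto_mult qpoch_tendsto[OF p5(4)]]) simp_all
  moreover have "(\<lambda>N. qpoch q (5 * N)) \<longlonglongrightarrow> euler_phi q"
    by (rule filterlim_compose[OF qpoch_tendsto[OF q(1)] filterlim_subseq]) (simp add: strict_mono_def)
  ultimately have "euler_phi q = theta p 5 1 * theta p 5 3 / euler_phi (q ^ 5)"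
    using euler_phi_nonzero[OF p5(4)] LIMSEQ_unique by fastforce
  moreover have "q ^ 5 = p ^ 10" by (simp add: q_def flip: power_mult)
  ultimately show ?thesis
    using euler_phi_nonzero[OF p5(4)] by (simp add: q_def)
qed

section \<open>Jacobi's series for the cube of the Euler product\<close>

text \<open>The derivative at z = 1 of the finite triple product, whose product side vanishes there
  through the factor 1 - z. Differentiating before the limit means that only finite sums are
  differentiated.\<close>

lemma finite_jacobi_cube:
  fixes p :: "'a :: real_normed_field"
  assumes p: "p \<noteq> 0" "norm p < 1"
  shows "- (qpoch (p\<^sup>2) N * qpoch (p\<^sup>2) (Suc N)) =
         (\<Sum>n\<in>{- int (Suc N)..int (Suc N)}. (-1) powi n * of_int n * p powi (n\<^sup>2 - n) * qbinom (p\<^sup>2) (2 * Suc N) (nat (int (Suc N) + n)))"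
proof -
  define a where "a = (\<lambda>n. (-1) powi n * p powi (n\<^sup>2 - n) * qbinom (p\<^sup>2) (2 * Suc N) (nat (int (Suc N) + n)))"
  let ?S = "{- int (Suc N)..int (Suc N)}"
  define h where "h = (\<lambda>z. (\<Prod>i<N. 1 - z * p\<^sup>2 ^ Suc i) * (\<Prod>i<Suc N. 1 - p\<^sup>2 ^ Suc i / z))"
  have eq: "(1 - z) * h z = (\<Sum>n\<in>?S. a n * z powi n)" if "z \<noteq> 0" for z
    using finite_jacobi_triple_product[OF p that, of "Suc N"]
    unfolding h_def a_def prod.lessThan_Suc_shift[of "\<lambda>i. 1 - z * p\<^sup>2 ^ i"] 
    by (simp add: mult_ac del: power_Suc prod.lessThan_Suc of_nat_Suc)
  \<comment> \<open>Continuity suffices: by Caratheodory's criterion (1 - z) h(z) has difference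
    quotient -h(z) at 1, so \<open>h\<close> itself is never differentiated.\<close>
  have "isCont h 1"
    unfolding h_def by (intro continuous_intros) auto
  then have "((\<lambda>z. (1 - z) * h z) has_field_derivative - h 1) (at 1)"
    unfolding CARAT_DERIV by (intro exI[of _ "\<lambda>z. - h z"]) (auto intro!: continuous_intros simp: algebra_simps)
  then have "((\<lambda>z. \<Sum>n\<in>?S. a n * z powi n) has_field_derivative - h 1) (at 1)"
    by (rule has_field_derivative_transform_within_open[where S = "- {0}"]) (auto simp: eq)
  moreover have "((\<lambda>z. \<Sum>n\<in>?S. a n * z powi n) has_field_derivative (\<Sum>n\<in>?S. a n * (of_int n * 1 powi (n - 1) * 1))) (at 1)"
    by (intro DERIV_sum DERIV_cmult DERIV_power_int DERIV_ident) auto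
  ultimately have "- h 1 = (\<Sum>n\<in>?S. a n * (of_int n * 1 powi (n - 1) * 1))"
    by (rule DERIV_unique)
  moreover have "h 1 = qpoch (p\<^sup>2) N * qpoch (p\<^sup>2) (Suc N)"
    by (simp add: h_def qpoch_def del: power_Suc)
  ultimately show ?thesis
    by (simp add: a_def mult_ac del: of_nat_Suc)
qed

text \<open>The limit series with weight n is used twice. Replacing n by -n and by n + 1 turns its
  negative into series with weights n and n + 1 and the same powers; their sum has the weight 2n +
  1.\<close>

lemma jacobi_cube:
  fixes p :: "'a :: {real_normed_field, banach, second_countable_topology}"
  assumes p: "p \<noteq> 0" "norm p < 1"
  shows "theta_moment 1 p 1 1 = 2 * euler_phi (p\<^sup>2) ^ 3"
proof -
  have q: "norm (p\<^sup>2) < 1" using p(2) by (rule norm_power2_less_1)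
  let ?c = "\<lambda>n. (-1) powi n * of_int n * p powi (n\<^sup>2 - n)"
  have "(\<lambda>n. norm (((-1) powi n * of_int n) * p powi (1 * n\<^sup>2 + (-1) * n))) summable_on UNIV"
    by (rule theta_abs_summable[where K = 1 and k = 1]) (use p in \<open>auto simp: norm_mult\<close>)
  then have sm: "(\<lambda>n. norm (?c n)) summable_on UNIV" by simp
  from central_qbinom_sum_tendsto[OF q this, THEN LIMSEQ_Suc]
  have "(\<lambda>N. - (qpoch (p\<^sup>2) N * qpoch (p\<^sup>2) (Suc N))) \<longlonglongrightarrow> (\<Sum>\<^sub>\<infinity>n. ?c n) / euler_phi (p\<^sup>2)"
    unfolding finite_jacobi_cube[OF p] .
  moreover have "(\<lambda>N. - (qpoch (p\<^sup>2) N * qpoch (p\<^sup>2) (Suc N))) \<longlonglongrightarrow> - (euler_phi (p\<^sup>2) * euler_phi (p\<^sup>2))"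
    by (intro tendsto_minus tendsto_mult qpoch_tendsto q LIMSEQ_Suc)
  ultimately have "(\<Sum>\<^sub>\<infinity>n. ?c n) / euler_phi (p\<^sup>2) = - (euler_phi (p\<^sup>2) * euler_phi (p\<^sup>2))"
    by (rule LIMSEQ_unique)
  then have c: "(\<Sum>\<^sub>\<infinity>n. ?c n) = - (euler_phi (p\<^sup>2) ^ 3)"
    using euler_phi_nonzero[OF q] by (simp add: field_simps power3_eq_cube)
  have "(?c has_sum (- (euler_phi (p\<^sup>2) ^ 3))) UNIV"
    using has_sum_infsum[OF abs_summable_summable[OF sm]] unfolding c .
  then have c': "((\<lambda>n. - ?c n) has_sum (euler_phi (p\<^sup>2) ^ 3)) UNIV"
    by (simp only: has_sum_uminus)
  have 1: "((\<lambda>n. (-1) powi n * of_int n * p powi (n\<^sup>2 + n)) has_sum (euler_phi (p\<^sup>2) ^ 3)) UNIV"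
    by (rule has_sum_reindex_bij_witness[of _ uminus uminus, THEN iffD2, OF _ _ _ _ _ _ c']) 
       (auto simp: minus_one_powi)
  have 2: "((\<lambda>n. (-1) powi n * (of_int n + 1) * p powi (n\<^sup>2 + n)) has_sum (euler_phi (p\<^sup>2) ^ 3)) UNIV"
  proof (rule has_sum_reindex_bij_witness[of _ "\<lambda>n. n - 1" "\<lambda>n. n + 1", THEN iffD2, OF _ _ _ _ _ _ c'])
    fix n :: int
    have "(n + 1)\<^sup>2 - (n + 1) = n\<^sup>2 + n" by (simp add: power2_eq_square algebra_simps)
    then show "- ((-1) powi (n + 1) * of_int (n + 1) * p powi ((n + 1)\<^sup>2 - (n + 1))) = 
       (-1) powi n * (of_int n + 1) * p powi (n\<^sup>2 + n)"
      by (simp only:) (simp add: minus_one_powi algebra_simps)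
  qed auto
  show ?thesis
    unfolding theta_moment_def using has_sum_add[OF 1 2] 
    by (intro infsumI) (simp add: algebra_simps)
qed

section \<open>Fifth roots of unity\<close>

text \<open>Inverse roots are paired. The middle coefficients S = w + w^4 and T = w^2 + w^3 satisfy
  S + T = ST = -1, which settles the expansion in any field.\<close>

lemma prod_fifth_roots_of_unity:
  fixes w a b :: "'a :: field"
  assumes "w ^ 5 = 1" "w \<noteq> 1"
  shows "(\<Prod>k<5. a - w ^ k * b) = a ^ 5 - b ^ 5"
proof -
  have "(w - 1) * (1 + w + w ^ 2 + w ^ 3 + w ^ 4) = w ^ 5 - 1"
    by (simp add: algebra_simps eval_nat_numeral)
  then have "(w - 1) * (1 + w + w ^ 2 + w ^ 3 + w ^ 4) = 0"
    by (simp only: assms(1) diff_self)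
  with assms(2) have "1 + w + w ^ 2 + w ^ 3 + w ^ 4 = 0"
    by (simp only: mult_eq_0_iff right_minus_eq) simp
  then have s: "w ^ 4 = - (1 + w + w ^ 2 + w ^ 3)"
    by (simp only: add_eq_0_iff)
  define S T where "S = w + w ^ 4" and "T = w ^ 2 + w ^ 3"
  have ST: "S + T = - 1" unfolding S_def T_def s by simp
  have "S * T = w ^ 3 + w ^ 4 + w ^ 5 * w + w ^ 5 * w ^ 2"
    unfolding S_def T_def by (simp add: algebra_simps eval_nat_numeral)
  also have "\<dots> = S + T" unfolding assms(1) S_def T_def by simp
  finally have ST': "S * T = - 1" using ST by simp
  have "(\<Prod>k<5. a - w ^ k * b) = (a - b) * ((a - w * b) * (a - w ^ 4 * b)) * ((a - w ^ 2 * b) * (a - w ^ 3 * b))"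
    by (simp add: eval_nat_numeral mult_ac)
  also have "(a - w * b) * (a - w ^ 4 * b) = a ^ 2 - S * (a * b) + w ^ 5 * b ^ 2"
    unfolding S_def by (simp add: algebra_simps eval_nat_numeral)
  also have "(a - w ^ 2 * b) * (a - w ^ 3 * b) = a ^ 2 - T * (a * b) + w ^ 5 * b ^ 2"
    unfolding T_def by (simp add: algebra_simps eval_nat_numeral)
  also have "(a - b) * (a ^ 2 - S * (a * b) + w ^ 5 * b ^ 2) * (a ^ 2 - T * (a * b) + w ^ 5 * b ^ 2) =
    (a - b) * (a ^ 4 - (S + T) * a ^ 3 * b + (2 + S * T) * a ^ 2 * b ^ 2 - (S + T) * a * b ^ 3 + b ^ 4)"
    unfolding assms(1) by (simp add: algebra_simps eval_nat_numeral)
  also have "\<dots> = a ^ 5 - b ^ 5"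
    unfolding ST ST' by (simp add: algebra_simps eval_nat_numeral)
  finally show ?thesis .
qed

text \<open>Each factor splits over the golden ratio \<open>\<alpha>\<close> and its conjugate \<open>\<beta>\<close>, where
  \<open>\<alpha>\<^sup>5 + \<beta>\<^sup>5 = 11\<close> and \<open>\<alpha>\<^sup>5 \<beta>\<^sup>5 = - 1\<close>.\<close>

lemma prod_fifth_roots_golden:
  fixes w a b :: complex
  assumes "w ^ 5 = 1" "w \<noteq> 1"
  shows "(\<Prod>k<5. a\<^sup>2 - w ^ k * (a * b) - (w ^ k)\<^sup>2 * b\<^sup>2) = a ^ 10 - 11 * (a ^ 5 * b ^ 5) - b ^ 10"
proof -
  define \<alpha> \<beta> :: complex where "\<alpha> = (1 + of_real (sqrt 5)) / 2" and "\<beta> = 1 - \<alpha>"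
  have "(of_real (sqrt 5) :: complex)\<^sup>2 = 5"
    by (simp flip: of_real_power)
  then have a2: "\<alpha>\<^sup>2 = \<alpha> + 1"
    unfolding \<alpha>_def by (simp add: power2_eq_square field_simps)
  have ab: "\<alpha> * \<beta> = - 1"
    unfolding \<beta>_def using a2 by (simp add: algebra_simps power2_eq_square)
  have "\<beta>\<^sup>2 = \<beta> + 1"
    unfolding \<beta>_def using a2 by (simp add: algebra_simps power2_eq_square)
  \<comment> \<open>The coefficients are Fibonacci numbers. Adding the two conjugates gives 5 * 1 +
    2 * 3, the source of the constant 11.\<close>
  moreover have "x ^ 5 = 5 * x + 3" if "x\<^sup>2 = x + 1" for x :: complex
  proof -
    have "x ^ 5 - (5 * x + 3) = (x\<^sup>2 - (x + 1)) * (x ^ 3 + x\<^sup>2 + 2 * x + 3)"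
      by (simp add: algebra_simps eval_nat_numeral)
    then show ?thesis unfolding that by simp
  qed
  ultimately have sum5: "\<alpha> ^ 5 + \<beta> ^ 5 = 11"
    using a2 unfolding \<beta>_def by (simp add: algebra_simps)
  have prod5: "\<alpha> ^ 5 * \<beta> ^ 5 = - 1"
    using ab by (simp flip: power_mult_distrib)
  have "a\<^sup>2 - x * (a * b) - x\<^sup>2 * b\<^sup>2 = (a - x * (\<alpha> * b)) * (a - x * (\<beta> * b))" for x
  proof -
    have "(a - x * (\<alpha> * b)) * (a - x * (\<beta> * b)) = a\<^sup>2 - (\<alpha> + \<beta>) * x * (a * b) + (\<alpha> * \<beta>) * (x\<^sup>2 * b\<^sup>2)"
      by (simp add: algebra_simps power2_eq_square)
    then show ?thesis unfolding ab by (simp add: \<beta>_def)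
  qed
  then have "(\<Prod>k<5. a\<^sup>2 - w ^ k * (a * b) - (w ^ k)\<^sup>2 * b\<^sup>2) = 
      (\<Prod>k<5. a - w ^ k * (\<alpha> * b)) * (\<Prod>k<5. a - w ^ k * (\<beta> * b))"
    by (simp add: prod.distrib)
  also have "\<dots> = (a ^ 5 - (\<alpha> * b) ^ 5) * (a ^ 5 - (\<beta> * b) ^ 5)"
    by (simp only: prod_fifth_roots_of_unity[OF assms])
  also have "\<dots> = a ^ 10 - (\<alpha> ^ 5 + \<beta> ^ 5) * (a ^ 5 * b ^ 5) + (\<alpha> ^ 5 * \<beta> ^ 5) * b ^ 10"
    by (simp add: algebra_simps power_mult_distrib flip: power_add)
  finally show ?thesis unfolding sum5 prod5 by simp
qed

text \<open>An exponent m prime to 5 contributes 1 - y^(5m), since w^m is again a primitive root; a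
  multiple m of 5 contributes (1 - y^m)^5. The factor \<open>qpoch (y ^ 25) N\<close> fills in the
  exponents missing from \<open>qpoch (y ^ 5) (5 * N)\<close>.\<close>

lemma prod_qpoch_fifth_roots:
  fixes w y :: "'a :: field"
  assumes w: "w ^ 5 = 1" "w \<noteq> 1"
  shows "(\<Prod>k<5. qpoch (w ^ k * y) (5 * N)) * qpoch (y ^ 25) N = qpoch (y ^ 5) (5 * N) * qpoch (y ^ 5) N ^ 5"
proof (induction N)
  case (Suc N)
  have e: "5 * Suc N = Suc (Suc (Suc (Suc (Suc (5 * N)))))" by simp
  have wN: "w ^ (5 * N) = 1" using w by (simp add: power_mult)
  have step: "(\<Prod>k<5. 1 - (w ^ k * y) ^ (5 * N + j)) = 1 - (y ^ 5) ^ (5 * N + j)" if "j \<in> {1, 2, 3, 4}" for j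
  proof -
    have j5: "(w ^ j) ^ 5 = 1"
      using w by (metis mult.commute power_mult power_one)
    have j1: "w ^ j \<noteq> 1"
    proof
      assume *: "w ^ j = 1"
      have e: "w ^ 5 = w\<^sup>2 * w\<^sup>2 * w" "w ^ 5 * w ^ 5 = w ^ 3 * w ^ 3 * w ^ 3 * w" "w ^ 5 = w ^ 4 * w"
        by (simp_all add: eval_nat_numeral mult_ac)
      from that consider "j = 1" | "j = 2" | "j = 3" | "j = 4" by auto
      then have "w = 1"
      proof cases
        case 1 with * show ?thesis by simp
      next
        case 2 with * have "w\<^sup>2 = 1" by simp
        show ?thesis using e(1) unfolding w(1) \<open>w\<^sup>2 = 1\<close> by simp
      next
        case 3 with * have "w ^ 3 = 1" by simp
        show ?thesis using e(2) unfolding w(1) \<open>w ^ 3 = 1\<close> by simp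
      next
        case 4 with * have "w ^ 4 = 1" by simp
        show ?thesis using e(3) unfolding w(1) \<open>w ^ 4 = 1\<close> by simp
      qed
      then show False using w by simp
    qed
    have "(w ^ k * y) ^ (5 * N + j) = (w ^ j) ^ k * y ^ (5 * N + j)" for k
    proof -
      have "(w ^ k) ^ (5 * N + j) = (w ^ (5 * N)) ^ k * (w ^ j) ^ k"
        by (simp add: algebra_simps flip: power_mult power_add)
      then show ?thesis by (simp add: power_mult_distrib wN)
    qed
    then have "(\<Prod>k<5. 1 - (w ^ k * y) ^ (5 * N + j)) = 1 ^ 5 - (y ^ (5 * N + j)) ^ 5"
      using prod_fifth_roots_of_unity[OF j5 j1, of 1] by simp
    also have "(y ^ (5 * N + j)) ^ 5 = (y ^ 5) ^ (5 * N + j)"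
      by (simp only: mult.commute flip: power_mult)
    finally show ?thesis by simp
  qed
  have last: "(\<Prod>k<5. 1 - (w ^ k * y) ^ (5 * N + 5)) = (1 - (y ^ 5) ^ Suc N) ^ 5"
  proof -
    have "(w ^ k * y) ^ (5 * N + 5) = (y ^ 5) ^ Suc N" for k
    proof -
      have "(w ^ k) ^ (5 * Suc N) = (w ^ 5) ^ (k * Suc N)"
        by (simp only: mult_ac flip: power_mult)
      then have "(w ^ k * y) ^ (5 * Suc N) = (y ^ 5) ^ Suc N"
        using w by (simp add: power_mult_distrib power_mult del: mult_Suc_right mult_Suc)
      then show ?thesis by (simp add: add.commute)
    qed
    then show ?thesis by simp
  qed
  have y25: "(y ^ 25) ^ Suc N = (y ^ 5) ^ (5 * N + 5)"
    unfolding power_mult[symmetric] by (simp add: add.commute)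
  have "(\<Prod>k<5. qpoch (w ^ k * y) (5 * Suc N)) = (\<Prod>k<5. qpoch (w ^ k * y) (5 * N)) *
     ((\<Prod>k<5. 1 - (w ^ k * y) ^ (5 * N + 1)) * (\<Prod>k<5. 1 - (w ^ k * y) ^ (5 * N + 2)) *
     (\<Prod>k<5. 1 - (w ^ k * y) ^ (5 * N + 3)) * (\<Prod>k<5. 1 - (w ^ k * y) ^ (5 * N + 4))) *
     (\<Prod>k<5. 1 - (w ^ k * y) ^ (5 * N + 5))"
    unfolding e qpoch_Suc prod.distrib by (simp add: mult.assoc eval_nat_numeral del: power_Suc prod.lessThan_Suc)
  also have "\<dots> = (\<Prod>k<5. qpoch (w ^ k * y) (5 * N)) *
     ((1 - (y ^ 5) ^ (5 * N + 1)) * (1 - (y ^ 5) ^ (5 * N + 2)) *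
      (1 - (y ^ 5) ^ (5 * N + 3)) * (1 - (y ^ 5) ^ (5 * N + 4))) * (1 - (y ^ 5) ^ Suc N) ^ 5"
    by (simp only: step last insert_iff simp_thms)
  finally have "(\<Prod>k<5. qpoch (w ^ k * y) (5 * Suc N)) * qpoch (y ^ 25) (Suc N) =
     ((\<Prod>k<5. qpoch (w ^ k * y) (5 * N)) * qpoch (y ^ 25) N) *
     ((1 - (y ^ 5) ^ (5 * N + 1)) * (1 - (y ^ 5) ^ (5 * N + 2)) *
      (1 - (y ^ 5) ^ (5 * N + 3)) * (1 - (y ^ 5) ^ (5 * N + 4)) * (1 - (y ^ 5) ^ (5 * N + 5))) * (1 - (y ^ 5) ^ Suc N) ^ 5"
    unfolding qpoch_Suc[of "y ^ 25"] y25 by (simp only: mult_ac)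
  also have "\<dots> = (qpoch (y ^ 5) (5 * N) * 
      ((1 - (y ^ 5) ^ (5 * N + 1)) * (1 - (y ^ 5) ^ (5 * N + 2)) *
      (1 - (y ^ 5) ^ (5 * N + 3)) * (1 - (y ^ 5) ^ (5 * N + 4)) * (1 - (y ^ 5) ^ (5 * N + 5)))) 
      * (qpoch (y ^ 5) N * (1 - (y ^ 5) ^ Suc N)) ^ 5"
    unfolding Suc.IH power_mult_distrib by (simp only: mult_ac)
  also have "qpoch (y ^ 5) (5 * N) * 
      ((1 - (y ^ 5) ^ (5 * N + 1)) * (1 - (y ^ 5) ^ (5 * N + 2)) *
      (1 - (y ^ 5) ^ (5 * N + 3)) * (1 - (y ^ 5) ^ (5 * N + 4)) * (1 - (y ^ 5) ^ (5 * N + 5))) = qpoch (y ^ 5) (5 * Suc N)"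
    unfolding e qpoch_Suc by (simp add: mult.assoc eval_nat_numeral del: power_Suc)
  finally show ?case unfolding qpoch_Suc .
qed simp

lemma norm_power_less_1:
  fixes x :: "'a :: real_normed_field"
  assumes "norm x < 1" "0 < n"
  shows "norm (x ^ n) < 1"
  using assms by (simp add: norm_power power_less_one_iff)

lemma prod_euler_phi_fifth_roots:
  fixes w y :: "'a :: {real_normed_field, banach}"
  assumes w: "w ^ 5 = 1" "w \<noteq> 1" "norm w = 1" and y: "norm y < 1"
  shows "(\<Prod>k<5. euler_phi (w ^ k * y)) * euler_phi (y ^ 25) = euler_phi (y ^ 5) ^ 6"
proof -
  have n: "norm (w ^ k * y) < 1" for k
    using w y by (simp add: norm_mult norm_power)
  have five: "filterlim (\<lambda>N :: nat. 5 * N) at_top sequentially"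
    by (rule filterlim_subseq) (simp add: strict_mono_def)
  have "(\<lambda>N. (\<Prod>k<5. qpoch (w ^ k * y) (5 * N)) * qpoch (y ^ 25) N) 
     \<longlonglongrightarrow> (\<Prod>k<5. euler_phi (w ^ k * y)) * euler_phi (y ^ 25)"
    by (intro tendsto_mult tendsto_prod filterlim_compose[OF qpoch_tendsto five] qpoch_tendsto n norm_power_less_1 y) auto
  moreover have "(\<lambda>N. qpoch (y ^ 5) (5 * N) * qpoch (y ^ 5) N ^ 5) \<longlonglongrightarrow> euler_phi (y ^ 5) * euler_phi (y ^ 5) ^ 5"
    by (intro tendsto_mult tendsto_power filterlim_compose[OF qpoch_tendsto five] qpoch_tendsto norm_power_less_1 y) auto
  ultimately have "(\<Prod>k<5. euler_phi (w ^ k * y)) * euler_phi (y ^ 25) = euler_phi (y ^ 5) * euler_phi (y ^ 5) ^ 5"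
    unfolding prod_qpoch_fifth_roots[OF w(1,2)] by (rule LIMSEQ_unique)
  then show ?thesis by (simp add: eval_nat_numeral)
qed

section \<open>Transfer to real arguments and the degree-ten identity\<close>

lemma euler_phi_of_real:
  assumes "\<bar>q\<bar> < 1"
  shows "euler_phi (of_real q :: 'a :: {real_normed_field, banach}) = of_real (euler_phi q)"
proof -
  have "(\<lambda>n. of_real (qpoch q n) :: 'a) \<longlonglongrightarrow> of_real (euler_phi q)"
    using assms by (intro tendsto_of_real qpoch_tendsto) simp
  moreover have "(\<lambda>n. of_real (qpoch q n) :: 'a) = qpoch (of_real q)"
    by (simp add: qpoch_def fun_eq_iff)
  moreover have "qpoch (of_real q :: 'a) \<longlonglongrightarrow> euler_phi (of_real q)"
    using assms by (intro qpoch_tendsto) simp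
  ultimately show ?thesis by (metis LIMSEQ_unique)
qed

lemma theta_of_real:
  assumes "p \<noteq> 0" "\<bar>p\<bar> < 1" "0 < a"
  shows "theta (of_real p :: 'a :: {real_normed_field, banach, second_countable_topology}) a b = of_real (theta p a b)"
proof -
  have "((\<lambda>n. (-1) powi n * p powi (a * n\<^sup>2 + b * n)) has_sum theta p a b) UNIV"
    unfolding theta_def using assms by (intro has_sum_infsum[OF abs_summable_summable[OF theta_summable]]) auto
  from has_sum_of_real[OF this, where 'a = 'a] show ?thesis
    unfolding theta_def[of "of_real p"] by (intro infsumI) (simp add: of_real_power_int)
qed

text \<open>The exponent has the parity of (a + b)n, so only even powers of p occur. This makes the
  choice of a square root of the nome immaterial.\<close>

lemma theta_cong_square:
  fixes p p' :: "'a :: {real_normed_field, banach, second_countable_topology}"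
  assumes "p\<^sup>2 = p'\<^sup>2" "even (a + b)"
  shows "theta p a b = theta p' a b"
proof -
  have "even (a * n\<^sup>2 + b * n)" for n
    using assms(2) by auto
  then have "p powi (a * n\<^sup>2 + b * n) = p' powi (a * n\<^sup>2 + b * n)" for n
    using assms(1) by (auto simp: power2_eq_iff power_int_minus_left)
  then show ?thesis by (simp add: theta_def)
qed

lemma theta_power:
  "theta (p ^ m) a b = theta p (int m * a) (int m * b)"
  by (simp add: theta_def power_int_power algebra_simps)

text \<open>The quadratic expansion is applied at the five fifth roots w^k y of q. The theta series
  in the nome q^5 then take their values at (w^k y)^5 = q, so they are the same for all k, and the
  five factors differ only by w^k in one form in G and yH.\<close>

lemma theta_fifth_power_identity:
  fixes p :: real
  assumes p: "0 < p" "p < 1"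
  defines "q \<equiv> p\<^sup>2"
  shows "(theta p 5 1 ^ 10 - 11 * q * (theta p 5 1 ^ 5 * theta p 5 3 ^ 5) - q\<^sup>2 * theta p 5 3 ^ 10) * euler_phi (q ^ 5)
     = euler_phi q ^ 11"
proof -
  define y where "y = root 5 q"
  have q: "0 < q" "q < 1" unfolding q_def using p by (auto simp: power_less_one_iff)
  have y5: "y ^ 5 = q" and y: "0 < y" "y < 1"
    unfolding y_def using q by (auto simp: real_root_lt_1_iff)
  define w where "w = cis (2 * pi / 5)"
  have w: "w ^ 5 = 1" "norm w = 1" "w \<noteq> 1"
  proof -
    show "w ^ 5 = 1" unfolding w_def Complex.DeMoivre by simp
    show "norm w = 1" unfolding w_def by simp
    have "sin (2 * pi / 5) > 0" by (rule sin_gt_zero) (auto simp: field_simps)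
    then show "w \<noteq> 1" unfolding w_def by (auto simp: complex_eq_iff)
  qed
  define G H \<phi> where "G = (of_real (theta p 5 1) :: complex)" and "H = (of_real (theta p 5 3) :: complex)"
    and "\<phi> = (of_real (euler_phi q) :: complex)"
  have main: "euler_phi (w ^ k * of_real y) * \<phi> = G\<^sup>2 - w ^ k * (G * (of_real y * H)) - (w ^ k)\<^sup>2 * (of_real y * H)\<^sup>2" for k
  proof -
    define x where "x = w ^ k * of_real y"
    define s where "s = csqrt x"
    have s2: "s\<^sup>2 = x" by (simp add: s_def)
    have nx: "norm x = y" unfolding x_def using w y by (simp add: norm_mult norm_power)
    have "s \<noteq> 0" using nx y s2 by auto
    moreover have "norm s < 1"
    proof (rule power_less_imp_less_base)
      show "norm s ^ 2 < 1 ^ 2"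
        using nx s2 y by (simp flip: norm_power)
    qed auto
    ultimately have s: "s \<noteq> 0" "norm s < 1" by auto
    have x5: "x ^ 5 = of_real q"
    proof -
      have "(w ^ k) ^ 5 = (w ^ 5) ^ k" by (simp only: mult.commute flip: power_mult)
      then show ?thesis using w by (simp add: x_def power_mult_distrib y5 flip: of_real_power)
    qed
    \<comment> \<open>The fifth power of \<open>s\<close> is p only up to sign; agreement of the
      squares is all that the theta series see.\<close>
    have s10: "(s ^ 5)\<^sup>2 = (of_real p)\<^sup>2"
      using x5 unfolding s2[symmetric] q_def by (simp flip: power_mult)
    have th: "theta s 25 (5 * b) = of_real (theta p 5 b)" if "odd b" for b
    proof -
      have "theta s 25 (5 * b) = theta (s ^ 5) 5 b" unfolding theta_power by simp
      also have "\<dots> = theta (of_real p) 5 b"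
        using s10 that by (intro theta_cong_square) auto
      finally show ?thesis using p by (simp add: theta_of_real)
    qed
    have "euler_phi x * euler_phi (x ^ 5) = theta s 5 1 * theta s 5 3"
      using theta_product_eq_euler_phi[OF s] unfolding s2[symmetric] by (simp flip: power_mult)
    also have "\<dots> = (theta s 25 (5 * 1))\<^sup>2 - s ^ 2 * theta s 25 (5 * 1) * theta s 25 (5 * 3) - s ^ 4 * (theta s 25 (5 * 3))\<^sup>2"
      using theta_product_expansion[OF s] by simp
    also have "\<dots> = G\<^sup>2 - x * (G * H) - x\<^sup>2 * H\<^sup>2"
      unfolding th[of 1, simplified] th[of 3, simplified] G_def H_def s2[symmetric]
      using th[of 1] th[of 3] by (simp flip: power_mult)
    finally have "euler_phi x * \<phi> = G\<^sup>2 - x * (G * H) - x\<^sup>2 * H\<^sup>2"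
      unfolding x5 \<phi>_def using q by (simp add: euler_phi_of_real)
    then show ?thesis
      unfolding x_def by (simp add: power_mult_distrib mult_ac)
  qed
  have "(\<Prod>k<5. euler_phi (w ^ k * of_real y) * \<phi>) = G ^ 10 - 11 * (G ^ 5 * (of_real y * H) ^ 5) - (of_real y * H) ^ 10"
    unfolding main by (rule prod_fifth_roots_golden[OF w(1,3)])
  then have 1: "(\<Prod>k<5. euler_phi (w ^ k * of_real y)) * \<phi> ^ 5 = G ^ 10 - 11 * (G ^ 5 * (of_real y * H) ^ 5) - (of_real y * H) ^ 10"
    by (simp add: prod.distrib)
  have 2: "(\<Prod>k<5. euler_phi (w ^ k * of_real y)) * euler_phi (of_real y ^ 25) = euler_phi (of_real y ^ 5) ^ 6"
    using y by (intro prod_euler_phi_fifth_roots w) auto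
  have y25: "y ^ 25 = q ^ 5" "y ^ 10 = q\<^sup>2"
    unfolding y5[symmetric] by (simp_all flip: power_mult)
  have q5: "q ^ 5 < 1" using q by (simp add: power_less_one_iff)
  have phi: "euler_phi (of_real (q ^ 5) :: complex) = of_real (euler_phi (q ^ 5))"
      "euler_phi (of_real q :: complex) = of_real (euler_phi q)"
    using q q5 by (auto intro!: euler_phi_of_real simp del: of_real_power)
  have "(G ^ 10 - 11 * (G ^ 5 * (of_real y * H) ^ 5) - (of_real y * H) ^ 10) * euler_phi (of_real (y ^ 25)) = \<phi> ^ 5 * euler_phi (of_real (y ^ 5)) ^ 6"
    unfolding 1[symmetric] of_real_power 2[symmetric] by (simp only: mult_ac)
  then have "of_real ((theta p 5 1 ^ 10 - 11 * (theta p 5 1 ^ 5 * (y * theta p 5 3) ^ 5) - (y * theta p 5 3) ^ 10) * euler_phi (q ^ 5))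
     = (of_real (euler_phi q ^ 5 * euler_phi q ^ 6) :: complex)"
    unfolding y25 y5 G_def H_def \<phi>_def phi by (simp only: of_real_power of_real_mult of_real_diff of_real_numeral)
  then have "(theta p 5 1 ^ 10 - 11 * (theta p 5 1 ^ 5 * (y * theta p 5 3) ^ 5) - (y * theta p 5 3) ^ 10) * euler_phi (q ^ 5)
     = euler_phi q ^ 5 * euler_phi q ^ 6"
    by (simp only: of_real_eq_iff)
  then show ?thesis
    by (simp add: power_mult_distrib y5 y25 mult_ac flip: power_add)
qed

section \<open>Derivatives of theta series\<close>

text \<open>For |b| < a the exponent is never negative and vanishes only at n = 0, so
  \<open>theta\<close> is a genuine power series, usable at p = 0 as well.\<close>

lemma quadratic_ge_abs_strict:
  fixes a b n :: int
  assumes "\<bar>b\<bar> < a"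
  shows "\<bar>n\<bar> \<le> a * n\<^sup>2 + b * n"
proof (cases "n = 0")
  case False
  have "\<bar>b * n\<bar> \<le> (a - 1) * \<bar>n\<bar>"
    using assms unfolding abs_mult by (intro mult_right_mono) auto
  then have "\<bar>n\<bar> \<le> a * \<bar>n\<bar> - \<bar>b * n\<bar>" by (simp add: algebra_simps)
  also have "a * \<bar>n\<bar> \<le> a * (\<bar>n\<bar> * \<bar>n\<bar>)"
    using False assms mult_left_mono[of 1 "\<bar>n\<bar>" "\<bar>n\<bar>"] by (intro mult_left_mono) auto
  also have "\<bar>n\<bar> * \<bar>n\<bar> = n\<^sup>2" by (simp add: power2_eq_square)
  also have "a * n\<^sup>2 - \<bar>b * n\<bar> \<le> a * n\<^sup>2 + b * n" by simp
  finally show ?thesis by simp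
qed simp

text \<open>Termwise differentiation on a closed disc of radius between |p| and 1. Natural-number
  exponents include p = 0, needed for the behaviour of u near q = 0; the truncated subtraction at n
  = 0 is harmless because its coefficient is zero.\<close>

lemma theta_has_derivative:
  fixes p :: real
  assumes p: "\<bar>p\<bar> < 1" and ab: "\<bar>b\<bar> < a"
  shows "((\<lambda>x. theta x a b) has_field_derivative
     (\<Sum>\<^sub>\<infinity>n. (-1) powi n * of_int (a * n\<^sup>2 + b * n) * p ^ (nat (a * n\<^sup>2 + b * n) - 1))) (at p)"
    (is "(_ has_field_derivative infsum (?t' p) UNIV) _")
proof -
  let ?e = "\<lambda>n. nat (a * n\<^sup>2 + b * n)"
  let ?t = "\<lambda>x n. (-1) powi n * x ^ ?e n"
  have e_ge: "\<bar>n\<bar> \<le> a * n\<^sup>2 + b * n" for n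
    using quadratic_ge_abs_strict[OF ab] .
  have e_int: "int (?e n) = a * n\<^sup>2 + b * n" for n
    using e_ge[of n] by simp
  have theta_nat: "theta x a b = (\<Sum>\<^sub>\<infinity>n. ?t x n)" for x :: real
    unfolding theta_def using e_ge
    by (intro infsum_cong) (metis power_int_nonneg_exp abs_ge_zero order.trans)
  obtain r where r: "\<bar>p\<bar> < r" "r < 1" using dense[OF p] by blast
  then have r0: "0 < r" by linarith
  \<comment> \<open>The quadratic factor bounds the coefficient an^2 + bn; the division by r pays
    for the exponent lowered by one.\<close>
  define M where "M = (\<lambda>n::int. (real_of_int (a + \<bar>b\<bar>) / r) * ((1 + \<bar>real_of_int n\<bar>) ^ 2 * r ^ nat \<bar>n\<bar>))"
  have M: "M summable_on UNIV"
    unfolding M_def using r r0 by (intro summable_on_cmult_right summable_on_int_poly_geometric) auto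
  have bound': "norm (?t' x n) \<le> M n" if "\<bar>x\<bar> \<le> r" for x n
  proof (cases "n = 0")
    case False
    have "\<bar>a * n\<^sup>2 + b * n\<bar> \<le> a * n\<^sup>2 + \<bar>b\<bar> * \<bar>n\<bar>"
      using ab by (intro order.trans[OF abs_triangle_ineq]) (simp add: abs_mult)
    also have "\<dots> \<le> a * (1 + \<bar>n\<bar>)\<^sup>2 + \<bar>b\<bar> * (1 + \<bar>n\<bar>)\<^sup>2"
    proof (intro add_mono mult_left_mono)
      have "(1 + \<bar>n\<bar>)\<^sup>2 = 1 + 2 * \<bar>n\<bar> + n\<^sup>2"
        by (simp add: power2_eq_square algebra_simps)
      then show "n\<^sup>2 \<le> (1 + \<bar>n\<bar>)\<^sup>2" "\<bar>n\<bar> \<le> (1 + \<bar>n\<bar>)\<^sup>2"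
        by auto
    qed (use ab in auto)
    also have "\<dots> = (a + \<bar>b\<bar>) * (1 + \<bar>n\<bar>)\<^sup>2"
      by (simp add: algebra_simps)
    finally have "real_of_int \<bar>a * n\<^sup>2 + b * n\<bar> \<le> of_int ((a + \<bar>b\<bar>) * (1 + \<bar>n\<bar>)\<^sup>2)"
      by (simp only: of_int_le_iff)
    then have 1: "\<bar>real_of_int (a * n\<^sup>2 + b * n)\<bar> \<le> of_int (a + \<bar>b\<bar>) * (1 + \<bar>real_of_int n\<bar>)\<^sup>2"
      by simp
    have "\<bar>x\<bar> ^ (?e n - 1) \<le> r ^ (?e n - 1)"
      using that by (intro power_mono) auto
    also have "\<dots> \<le> r ^ (nat \<bar>n\<bar> - 1)"
      using r r0 e_ge[of n] by (intro power_decreasing diff_le_mono nat_mono) auto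
    also have "\<dots> = r ^ nat \<bar>n\<bar> / r"
      using False r0 by (simp add: power_diff)
    finally have px: "\<bar>x\<bar> ^ (?e n - 1) \<le> r ^ nat \<bar>n\<bar> / r" .
    have "0 \<le> real_of_int (a + \<bar>b\<bar>) * (1 + \<bar>real_of_int n\<bar>)\<^sup>2"
      using ab by (intro mult_nonneg_nonneg) auto
    from mult_mono[OF 1 px this]
    have "\<bar>real_of_int (a * n\<^sup>2 + b * n)\<bar> * \<bar>x\<bar> ^ (?e n - 1) \<le> 
       (of_int (a + \<bar>b\<bar>) * (1 + \<bar>real_of_int n\<bar>)\<^sup>2) * (r ^ nat \<bar>n\<bar> / r)"
      by simp
    then show ?thesis
      unfolding M_def real_norm_def abs_mult power_abs[symmetric] by (simp add: norm_minus_one_powi[unfolded real_norm_def] mult_ac)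
  next
    case True
    then show ?thesis using r0 ab by (simp add: M_def)
  qed
  have bound: "norm (?t x n) \<le> r ^ nat \<bar>n\<bar>" if "\<bar>x\<bar> \<le> r" for x n
  proof -
    have "\<bar>x\<bar> ^ ?e n \<le> r ^ ?e n" using that by (intro power_mono) auto
    also have "\<dots> \<le> r ^ nat \<bar>n\<bar>"
      using r r0 e_ge[of n] by (intro power_decreasing nat_mono) auto
    finally show ?thesis by (simp add: abs_mult norm_minus_one_powi[unfolded real_norm_def] power_abs)
  qed
  have M0: "(\<lambda>n. r ^ nat \<bar>n\<bar>) summable_on (UNIV :: int set)"
    using summable_on_int_poly_geometric[of r 0] r r0 by simp
  have conv: "summable (\<lambda>k. norm (h (int_decode k))) \<and> infsum h UNIV = (\<Sum>k. h (int_decode k))" 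
    if "\<And>n. norm (h n) \<le> B n" "B summable_on UNIV" for h B :: "int \<Rightarrow> real"
  proof -
    have h: "(\<lambda>n. norm (h n)) summable_on UNIV"
      by (rule summable_on_comparison_test[OF that(2)]) (use that in auto)
    have *: "(\<lambda>k. g (int_decode k)) sums infsum g UNIV" if "g summable_on UNIV" for g :: "int \<Rightarrow> real"
      by (rule has_sum_imp_sums, subst has_sum_reindex_bij_betw[OF bij_int_decode]) (use that in simp)
    show ?thesis using *[OF h] *[OF abs_summable_summable[OF h]] by (simp add: sums_iff)
  qed
  have M_sums: "summable (\<lambda>k. M (int_decode k))"
  proof -
    have "norm (M n) \<le> M n" for n
      unfolding M_def using r0 ab by (simp add: abs_mult)
    from conv[OF this M] show ?thesis by (auto intro: summable_norm_cancel)
  qed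
  have "((\<lambda>x. \<Sum>k. ?t x (int_decode k)) has_field_derivative (\<Sum>k. ?t' p (int_decode k))) (at p)"
  proof (rule has_field_derivative_series'(2)[where S = "cball 0 r"])
    show "convex (cball 0 r :: real set)" by simp
    show "((\<lambda>x. ?t x (int_decode k)) has_field_derivative ?t' x (int_decode k)) (at x within cball 0 r)" for k x
    proof -
      let ?n = "int_decode k"
      have "((\<lambda>x. ?t x ?n) has_field_derivative (-1) powi ?n * (real (?e ?n) * x ^ (?e ?n - 1))) (at x within cball 0 r)"
        by (auto intro!: derivative_eq_intros)
      moreover have "real (?e ?n) = of_int (a * ?n\<^sup>2 + b * ?n)"
        using e_int[of ?n] by (metis of_int_of_nat_eq)
      ultimately show ?thesis by (simp only: mult.assoc)
    qed
    show "uniformly_convergent_on (cball 0 r) (\<lambda>n x. \<Sum>i<n. ?t' x (int_decode i))"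
      by (rule Weierstrass_m_test'[OF _ M_sums]) (use bound' in auto)
    show "(0 :: real) \<in> cball 0 r" using r0 by simp
    show "summable (\<lambda>n. ?t (0 :: real) (int_decode n))"
    proof (rule summable_norm_cancel)
      have "norm (?t (0 :: real) n) \<le> r ^ nat \<bar>n\<bar>" for n
        by (rule bound) (use r0 in simp)
      from conv[OF this M0] show "summable (\<lambda>n. norm (?t (0 :: real) (int_decode n)))" by blast
    qed
    show "p \<in> interior (cball 0 r)" using r by simp
  qed
  moreover have "(\<Sum>k. ?t' p (int_decode k)) = infsum (?t' p) UNIV"
    using conv[OF bound'[of p] M] r by simp
  moreover have ev: "\<forall>\<^sub>F x in nhds p. (\<Sum>k. ?t x (int_decode k)) = theta x a b"
  proof -
    have "\<forall>\<^sub>F x in nhds p. x \<in> ball 0 r"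
      using r by (intro eventually_nhds_in_open) auto
    then show ?thesis
    proof eventually_elim
      case (elim x)
      then show ?case unfolding theta_nat using conv[OF bound[of x] M0] by simp
    qed
  qed
  ultimately show ?thesis
    using DERIV_cong_ev[OF refl ev refl] by simp
qed

lemma theta_moment_2_deriv:
  fixes p :: real
  assumes p: "p \<noteq> 0" "\<bar>p\<bar> < 1" and ab: "\<bar>b\<bar> < a"
  obtains D where "((\<lambda>x. theta x a b) has_field_derivative D) (at p)"
    "theta_moment 2 p a b = 4 * of_int a * p * D + (of_int b)\<^sup>2 * theta p a b"
proof
  let ?D = "\<Sum>\<^sub>\<infinity>n. (-1) powi n * of_int (a * n\<^sup>2 + b * n) * p ^ (nat (a * n\<^sup>2 + b * n) - 1)"
  show "((\<lambda>x. theta x a b) has_field_derivative ?D) (at p)"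
    by (rule theta_has_derivative[OF p(2) ab])
  have a: "0 < a" using ab by linarith
  let ?t = "\<lambda>n. (-1) powi n * p powi (a * n\<^sup>2 + b * n)"
  have th: "(?t has_sum theta p a b) UNIV"
    unfolding theta_def using p a by (intro has_sum_infsum[OF abs_summable_summable[OF theta_summable]]) auto
  have m: "((\<lambda>n. (-1) powi n * of_int (2 * a * n + b) ^ 2 * p powi (a * n\<^sup>2 + b * n)) has_sum theta_moment 2 p a b) UNIV"
    unfolding theta_moment_def using p a by (intro has_sum_infsum[OF abs_summable_summable[OF theta_moment_summable]]) auto
  have D: "(\<Sum>\<^sub>\<infinity>n. (4 * of_int a * p) * ((-1) powi n * of_int (a * n\<^sup>2 + b * n) * p ^ (nat (a * n\<^sup>2 + b * n) - 1)))
      = theta_moment 2 p a b - (of_int b)\<^sup>2 * theta p a b"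
  proof (rule infsumI)
    have "(\<lambda>n. (4 * of_int a * p) * ((-1) powi n * of_int (a * n\<^sup>2 + b * n) * p ^ (nat (a * n\<^sup>2 + b * n) - 1)))
       = (\<lambda>n. (-1) powi n * of_int (2 * a * n + b) ^ 2 * p powi (a * n\<^sup>2 + b * n) - (of_int b)\<^sup>2 * ?t n)"
    proof
      fix n :: int
      define e where "e = a * n\<^sup>2 + b * n"
      have "e \<ge> 0"
        using quadratic_ge_abs_strict[OF ab, of n] unfolding e_def by linarith
      \<comment> \<open>For e = 0 the powers on the two sides differ, since \<open>nat e - 1\<close>
        is 0; the factor \<open>of_int e\<close> saves the equation.\<close>
      then have pe: "of_int e * (p * p ^ (nat e - 1)) = of_int e * p powi e"
        by (cases "e = 0") (simp_all add: power_int_nonneg_exp flip: power_Suc)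
      have "real_of_int (2 * a * n + b) ^ 2 = 4 * of_int a * of_int e + (of_int b)\<^sup>2"
        unfolding e_def by (simp add: power2_eq_square algebra_simps)
      then have "(-1) powi n * of_int (2 * a * n + b) ^ 2 * p powi e - (of_int b)\<^sup>2 * ((-1) powi n * p powi e)
         = 4 * of_int a * (-1) powi n * (of_int e * p powi e)"
        by (simp add: algebra_simps)
      also have "\<dots> = (4 * of_int a * p) * ((-1) powi n * of_int e * p ^ (nat e - 1))"
        unfolding pe[symmetric] by (simp only: mult_ac)
      finally show "(4 * of_int a * p) * ((-1) powi n * of_int (a * n\<^sup>2 + b * n) * p ^ (nat (a * n\<^sup>2 + b * n) - 1))
        = (-1) powi n * of_int (2 * a * n + b) ^ 2 * p powi (a * n\<^sup>2 + b * n) - (of_int b)\<^sup>2 * ?t n"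
        unfolding e_def ..
    qed
    then show "((\<lambda>n. (4 * of_int a * p) * ((-1) powi n * of_int (a * n\<^sup>2 + b * n) * p ^ (nat (a * n\<^sup>2 + b * n) - 1)))
      has_sum (theta_moment 2 p a b - (of_int b)\<^sup>2 * theta p a b)) UNIV"
      by (simp only:) (intro has_sum_difference has_sum_cmult_right th m)
  qed
  then show "theta_moment 2 p a b = 4 * of_int a * p * ?D + (of_int b)\<^sup>2 * theta p a b"
    by (simp add: infsum_cmult_right')
qed

section \<open>The Rogers--Ramanujan continued fraction\<close>

text \<open>
  Up to the common factor \<open>(q; q)\<^sub>\<infinity>\<close>, these are the terms of the functions \<open>H\<^sub>1\<close> and \<open>H\<^sub>2\<close> of Hardy and Wright
  (section 19.14) at \<open>x = q ^ Suc i\<close>, where \<open>q = p\<^sup>2\<close>. At \<open>i = 0\<close> their sums are theta series, and their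
  recurrences in \<open>i\<close> generate the continued fraction.
\<close>

definition rr_coeff :: "real \<Rightarrow> nat \<Rightarrow> nat \<Rightarrow> real" where
  "rr_coeff p i r = qpoch (p\<^sup>2) (i + r) / qpoch (p\<^sup>2) r"

definition rr_term1 :: "real \<Rightarrow> nat \<Rightarrow> nat \<Rightarrow> real" where
  "rr_term1 p i r = (-1) ^ r * p ^ (r * (5 * r + 1) + 4 * i * r + 2 * r) * (1 - p ^ (2 * i + 2 + 4 * r)) * rr_coeff p i r"

definition rr_term2 :: "real \<Rightarrow> nat \<Rightarrow> nat \<Rightarrow> real" where
  "rr_term2 p i r = (-1) ^ r * p ^ (r * (5 * r + 1) + 4 * i * r) * (1 - p ^ (4 * i + 4 + 8 * r)) * rr_coeff p i r"

lemma rr_coeff_Suc: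
  assumes "0 < p" "p < 1"
  shows "(1 - p ^ (2 * (i + r) + 2)) * rr_coeff p i r = rr_coeff p (Suc i) r"
    and "(1 - p ^ (2 * Suc r)) * rr_coeff p i (Suc r) = rr_coeff p (Suc i) r"
proof -
  have n: "norm (p\<^sup>2) < 1" using assms by (simp add: power_less_one_iff)
  have e: "(p\<^sup>2) ^ Suc m = p ^ (2 * Suc m)" for m by (simp only: power_mult)
  show "(1 - p ^ (2 * (i + r) + 2)) * rr_coeff p i r = rr_coeff p (Suc i) r"
    using e[of "i + r"] unfolding rr_coeff_def add_Suc qpoch_Suc by (simp add: add.commute)
  show "(1 - p ^ (2 * Suc r)) * rr_coeff p i (Suc r) = rr_coeff p (Suc i) r"
    using qpoch_nonzero[OF n, of r] one_minus_power_nonzero[OF n, of r]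
    unfolding rr_coeff_def add_Suc add_Suc_right qpoch_Suc[of "p\<^sup>2" r] e by (simp add: divide_simps)
qed

lemma rr_coeff_bounded:
  assumes "0 < p" "p < 1"
  obtains K where "0 < K" "\<And>i r. \<bar>rr_coeff p i r\<bar> \<le> K"
proof -
  have n: "norm (p\<^sup>2) < 1" using assms by (simp add: power_less_one_iff)
  obtain L where L: "L > 0" "\<And>n. norm (qpoch (p\<^sup>2) n) \<le> L" "\<And>n. norm (inverse (qpoch (p\<^sup>2) n)) \<le> L"
    using qpoch_bounded[OF n] by blast
  have "\<bar>rr_coeff p i r\<bar> \<le> L * L" for i r
    unfolding rr_coeff_def divide_inverse abs_mult using L by (intro mult_mono) auto
  then show ?thesis using that[of "L * L"] L(1) by simp
qed

lemma summable_rr: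
  fixes p :: real
  assumes p: "0 < p" "p < 1" and e: "\<And>r. r \<le> e r" and c: "\<And>r. \<bar>c r\<bar> \<le> K"
  shows "summable (\<lambda>r. (-1) ^ r * p ^ e r * c r)"
proof (rule summable_comparison_test')
  show "summable (\<lambda>r. K * p ^ r)"
    using p by (intro summable_mult) auto
  show "norm ((-1) ^ r * p ^ e r * c r) \<le> K * p ^ r" for r
  proof -
    have "p ^ e r * \<bar>c r\<bar> \<le> p ^ r * K"
      using p e c by (intro mult_mono power_decreasing) auto
    then show ?thesis using p by (simp add: abs_mult mult.commute)
  qed
qed

text \<open>Both recurrences below arise this way: each term is split in two, and the first part of
  term r + 1 is regrouped with the second part of term r.\<close>

lemma suminf_split_shift:
  fixes f g :: "nat \<Rightarrow> real"
  assumes "summable f" "summable g" "f 0 = 0"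
  shows "(\<Sum>r. f r + g r) = (\<Sum>r. f (Suc r) + g r)"
proof -
  have "summable (\<lambda>r. f (Suc r))" using assms(1) by (simp add: summable_Suc_iff)
  then show ?thesis
    using suminf_split_head[OF assms(1)] assms by (simp flip: suminf_add)
qed

context
  fixes p :: real
  assumes p: "0 < p" "p < 1"
begin

lemma rr_coeff_mult_bounded:
  "\<exists>K>0. \<forall>i j r. \<bar>(1 - p ^ j) * rr_coeff p i r\<bar> \<le> K \<and> \<bar>p ^ j * rr_coeff p i r\<bar> \<le> K"
proof -
  obtain K where K: "0 < K" "\<And>i r. \<bar>rr_coeff p i r\<bar> \<le> K"
    using rr_coeff_bounded[OF p] by blast
  have j: "0 \<le> p ^ j" "p ^ j \<le> 1" for j using p by (auto intro: power_le_one)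
  have "\<bar>(1 - p ^ j) * rr_coeff p i r\<bar> \<le> 1 * K" "\<bar>p ^ j * rr_coeff p i r\<bar> \<le> 1 * K" for i j r
    unfolding abs_mult by (intro mult_mono; use j[of j] K in simp)+
  then show ?thesis using K by auto
qed

lemma rr_term1_summable: "summable (rr_term1 p i)"
proof -
  obtain K where "0 < K" and "\<forall>i j r. \<bar>(1 - p ^ j) * rr_coeff p i r\<bar> \<le> K \<and> \<bar>p ^ j * rr_coeff p i r\<bar> \<le> K"
    using rr_coeff_mult_bounded by auto
  then have K: "\<bar>(1 - p ^ j) * rr_coeff p i r\<bar> \<le> K" "\<bar>p ^ j * rr_coeff p i r\<bar> \<le> K" "0 < K" for i j r
    by auto
  have "summable (\<lambda>r. (-1) ^ r * p ^ (r * (5 * r + 1) + 4 * i * r + 2 * r) * ((1 - p ^ (2 * i + 2 + 4 * r)) * rr_coeff p i r))"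
    by (rule summable_rr[OF p _ K(1)]) simp
  then show ?thesis by (simp add: rr_term1_def[abs_def] mult_ac)
qed

lemma rr_term2_summable: "summable (rr_term2 p i)"
proof -
  obtain K where "0 < K" and "\<forall>i j r. \<bar>(1 - p ^ j) * rr_coeff p i r\<bar> \<le> K \<and> \<bar>p ^ j * rr_coeff p i r\<bar> \<le> K"
    using rr_coeff_mult_bounded by auto
  then have K: "\<bar>(1 - p ^ j) * rr_coeff p i r\<bar> \<le> K" "\<bar>p ^ j * rr_coeff p i r\<bar> \<le> K" "0 < K" for i j r
    by auto
  have "summable (\<lambda>r. (-1) ^ r * p ^ (r * (5 * r + 1) + 4 * i * r) * ((1 - p ^ (4 * i + 4 + 8 * r)) * rr_coeff p i r))"
    by (rule summable_rr[OF p _ K(1)]) simp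
  then show ?thesis by (simp add: rr_term2_def[abs_def] mult_ac)
qed

text \<open>With q = p^2, the split is 1 - q^(i+1+2r) = (1 - q^r) + q^r (1 - q^(i+r+1)). The first
  piece vanishes at r = 0 and may be shifted; after the shift both pieces carry the coefficient of
  level i + 1.\<close>

lemma rr_recurrence1: "(\<Sum>r. rr_term1 p i r) = (\<Sum>r. rr_term2 p (Suc i) r)"
proof -
  obtain K where "0 < K" and "\<forall>i j r. \<bar>(1 - p ^ j) * rr_coeff p i r\<bar> \<le> K \<and> \<bar>p ^ j * rr_coeff p i r\<bar> \<le> K"
    using rr_coeff_mult_bounded by auto
  then have K: "\<bar>(1 - p ^ j) * rr_coeff p i r\<bar> \<le> K" "\<bar>p ^ j * rr_coeff p i r\<bar> \<le> K" "0 < K" for i j r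
    by auto
  let ?e = "\<lambda>r. r * (5 * r + 1) + 4 * i * r + 2 * r"
  let ?f = "\<lambda>r. (-1) ^ r * p ^ ?e r * ((1 - p ^ (2 * r)) * rr_coeff p i r)"
  let ?g = "\<lambda>r. (-1) ^ r * p ^ ?e r * (p ^ (2 * r) * rr_coeff p (Suc i) r)"
  have f: "summable ?f" by (rule summable_rr[OF p _ K(1)]) simp
  have g: "summable ?g" by (rule summable_rr[OF p _ K(2)]) simp
  have eq: "?f (Suc r) + ?g r = rr_term2 p (Suc i) r" for r
  proof -
    have e: "?e (Suc r) = (r * (5 * r + 1) + 4 * Suc i * r) + (4 * Suc i + 4 + 8 * r)"
      "?e r + 2 * r = r * (5 * r + 1) + 4 * Suc i * r"
      by (simp_all add: algebra_simps)
    have "?f (Suc r) = - ((-1) ^ r * p ^ ?e (Suc r) * rr_coeff p (Suc i) r)"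
      unfolding rr_coeff_Suc(2)[OF p] by simp
    moreover have "?g r = (-1) ^ r * p ^ (?e r + 2 * r) * rr_coeff p (Suc i) r"
      by (simp only: power_add mult_ac)
    ultimately show ?thesis
      unfolding e rr_term2_def
      by (simp only: power_add right_diff_distrib left_diff_distrib mult_1_left mult_1_right mult_ac uminus_add_conv_diff)
  qed
  have "rr_term1 p i r = ?f r + ?g r" for r
  proof -
    have "p ^ (2 * i + 2 + 4 * r) = p ^ (2 * r) * p ^ (2 * (i + r) + 2)"
      unfolding power_add[symmetric] by (rule arg_cong[where f = "(^) p"]) simp
    moreover have "1 - a * b = (1 - a) + a * (1 - b)" for a b :: real
      by (simp add: algebra_simps)
    ultimately have "1 - p ^ (2 * i + 2 + 4 * r) = (1 - p ^ (2 * r)) + p ^ (2 * r) * (1 - p ^ (2 * (i + r) + 2))"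
      by (simp only:)
    then show ?thesis
      unfolding rr_term1_def rr_coeff_Suc(1)[OF p, symmetric] by (simp only: ring_distribs mult_ac)
  qed
  then have "(\<Sum>r. rr_term1 p i r) = (\<Sum>r. ?f r + ?g r)" by simp
  also have "\<dots> = (\<Sum>r. ?f (Suc r) + ?g r)"
    by (rule suminf_split_shift[OF f g]) simp
  also have "\<dots> = (\<Sum>r. rr_term2 p (Suc i) r)"
    by (simp only: eq)
  finally show ?thesis .
qed

text \<open>The same regrouping applied to the difference of the two series, whose bracket is (1 -
  q^r) + q^(i+1+3r) (1 - q^(i+r+1)) with q = p^2.\<close>

lemma rr_recurrence2:
  "(\<Sum>r. rr_term2 p i r) = (\<Sum>r. rr_term1 p i r) + p ^ (2 * i + 2) * (\<Sum>r. rr_term1 p (Suc i) r)"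
proof -
  obtain K where "0 < K" and "\<forall>i j r. \<bar>(1 - p ^ j) * rr_coeff p i r\<bar> \<le> K \<and> \<bar>p ^ j * rr_coeff p i r\<bar> \<le> K"
    using rr_coeff_mult_bounded by auto
  then have K: "\<bar>(1 - p ^ j) * rr_coeff p i r\<bar> \<le> K" "\<bar>p ^ j * rr_coeff p i r\<bar> \<le> K" "0 < K" for i j r
    by auto
  let ?e = "\<lambda>r. r * (5 * r + 1) + 4 * i * r"
  let ?f = "\<lambda>r. (-1) ^ r * p ^ ?e r * ((1 - p ^ (2 * r)) * rr_coeff p i r)"
  let ?g = "\<lambda>r. (-1) ^ r * p ^ ?e r * (p ^ (2 * i + 2 + 6 * r) * rr_coeff p (Suc i) r)"
  have f: "summable ?f" by (rule summable_rr[OF p _ K(1)]) simp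
  have g: "summable ?g" by (rule summable_rr[OF p _ K(2)]) simp
  have eq: "?f (Suc r) + ?g r = p ^ (2 * i + 2) * rr_term1 p (Suc i) r" for r
  proof -
    have e: "?e (Suc r) = (2 * i + 2) + (r * (5 * r + 1) + 4 * Suc i * r + 2 * r) + (2 * Suc i + 2 + 4 * r)"
      "?e r + (2 * i + 2 + 6 * r) = (2 * i + 2) + (r * (5 * r + 1) + 4 * Suc i * r + 2 * r)"
      by (simp_all add: algebra_simps)
    have "?f (Suc r) = - ((-1) ^ r * p ^ ?e (Suc r) * rr_coeff p (Suc i) r)"
      unfolding rr_coeff_Suc(2)[OF p] by simp
    moreover have "?g r = (-1) ^ r * p ^ (?e r + (2 * i + 2 + 6 * r)) * rr_coeff p (Suc i) r"
      by (simp only: power_add mult_ac)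
    ultimately show ?thesis
      unfolding e rr_term1_def
      by (simp only: power_add right_diff_distrib left_diff_distrib mult_1_left mult_1_right mult_ac uminus_add_conv_diff)
  qed
  have "rr_term2 p i r - rr_term1 p i r = ?f r + ?g r" for r
  proof -
    have "1 - p ^ (4 * i + 4 + 8 * r) - p ^ (2 * r) * (1 - p ^ (2 * i + 2 + 4 * r)) 
        = (1 - p ^ (2 * r)) + p ^ (2 * i + 2 + 6 * r) * (1 - p ^ (2 * (i + r) + 2))"
    proof -
      have "p ^ (4 * i + 4 + 8 * r) = p ^ (2 * r) * p ^ (2 * i + 2 + 4 * r) * p ^ (2 * (i + r) + 2)"
        "p ^ (2 * i + 2 + 6 * r) = p ^ (2 * r) * p ^ (2 * i + 2 + 4 * r)"
        unfolding power_add[symmetric] by (rule arg_cong[where f = "(^) p"]; simp)+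
      moreover have "1 - a * b * d - a * (1 - b) = (1 - a) + a * b * (1 - d)" for a b d :: real
        by (simp add: algebra_simps)
      ultimately show ?thesis by (simp only:)
    qed
    then have "(-1) ^ r * p ^ ?e r * rr_coeff p i r * (1 - p ^ (4 * i + 4 + 8 * r) - p ^ (2 * r) * (1 - p ^ (2 * i + 2 + 4 * r)))
        = (-1) ^ r * p ^ ?e r * rr_coeff p i r * ((1 - p ^ (2 * r)) + p ^ (2 * i + 2 + 6 * r) * (1 - p ^ (2 * (i + r) + 2)))"
      by (simp only:)
    then show ?thesis
      unfolding rr_term1_def rr_term2_def rr_coeff_Suc(1)[OF p, symmetric] power_add[of p "?e r" "2 * r"]
      by (simp only: ring_distribs mult_ac)
  qed
  then have "(\<Sum>r. rr_term2 p i r) - (\<Sum>r. rr_term1 p i r) = (\<Sum>r. ?f r + ?g r)" 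
    by (simp add: suminf_diff[OF rr_term2_summable rr_term1_summable])
  also have "\<dots> = (\<Sum>r. ?f (Suc r) + ?g r)"
    by (rule suminf_split_shift[OF f g]) simp
  also have "\<dots> = (\<Sum>r. p ^ (2 * i + 2) * rr_term1 p (Suc i) r)"
    by (simp only: eq)
  also have "\<dots> = p ^ (2 * i + 2) * (\<Sum>r. rr_term1 p (Suc i) r)"
    by (rule suminf_mult[OF rr_term1_summable])
  finally show ?thesis by simp
qed

text \<open>The factor p^(4ir) removes every term with r > 0, and the term r = 0 tends to the Euler
  product. Positivity of this limit later anchors the positivity of all the series.\<close>

lemma rr_series2_tendsto: "(\<lambda>i. \<Sum>r. rr_term2 p i r) \<longlonglongrightarrow> euler_phi (p\<^sup>2)"
proof -
  have n: "norm (p\<^sup>2) < 1" using p by (simp add: power_less_one_iff)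
  obtain K where "0 < K" and "\<forall>i j r. \<bar>(1 - p ^ j) * rr_coeff p i r\<bar> \<le> K \<and> \<bar>p ^ j * rr_coeff p i r\<bar> \<le> K"
    using rr_coeff_mult_bounded by auto
  then have K: "\<bar>(1 - p ^ j) * rr_coeff p i r\<bar> \<le> K" "\<bar>p ^ j * rr_coeff p i r\<bar> \<le> K" "0 < K" for i j r
    by auto
  have "(\<lambda>i. \<Sum>r. rr_term2 p i r) \<longlonglongrightarrow> (\<Sum>r. if r = 0 then euler_phi (p\<^sup>2) else 0)"
  proof (rule tannerys_theorem[THEN conjunct2, THEN conjunct2])
    show "(\<lambda>i. rr_term2 p i r) \<longlonglongrightarrow> (if r = 0 then euler_phi (p\<^sup>2) else 0)" for r
    proof (cases "r = 0")
      case True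
      have "(\<lambda>i. (1 - p ^ (4 * i + 4)) * qpoch (p\<^sup>2) i) \<longlonglongrightarrow> (1 - 0) * euler_phi (p\<^sup>2)"
      proof (intro tendsto_mult tendsto_diff tendsto_const qpoch_tendsto n)
        have "filterlim (\<lambda>i :: nat. 4 * i + 4) at_top sequentially"
          by (rule filterlim_subseq) (simp add: strict_mono_def)
        then show "(\<lambda>i. p ^ (4 * i + 4)) \<longlonglongrightarrow> 0"
          using p by (intro filterlim_compose[OF LIMSEQ_power_zero]) auto
      qed
      then show ?thesis using True by (simp add: rr_term2_def rr_coeff_def)
    next
      case False
      have "(\<lambda>i. K * p ^ i) \<longlonglongrightarrow> K * 0"
        using p by (intro tendsto_mult tendsto_const LIMSEQ_power_zero) auto
      then have K0: "(\<lambda>i. K * p ^ i) \<longlonglongrightarrow> 0" by simp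
      have le: "norm (rr_term2 p i r) \<le> K * p ^ i" for i
      proof -
        have "i \<le> i * r" using False by simp
        then have "i \<le> r * (5 * r + 1) + 4 * i * r" by (simp add: trans_le_add2)
        then have "p ^ (r * (5 * r + 1) + 4 * i * r) * \<bar>(1 - p ^ (4 * i + 4 + 8 * r)) * rr_coeff p i r\<bar> \<le> p ^ i * K"
          using p by (intro mult_mono[OF power_decreasing K(1)]) auto
        then show ?thesis using p by (simp add: rr_term2_def abs_mult mult_ac)
      qed
      have "(\<lambda>i. rr_term2 p i r) \<longlonglongrightarrow> 0"
        by (rule Lim_null_comparison[OF always_eventually K0]) (rule allI, rule le)
      then show ?thesis using False by simp
    qed
    have "norm (rr_term2 p i r) \<le> K * p ^ r" for i r
    proof -
      have "p ^ (r * (5 * r + 1) + 4 * i * r) * \<bar>(1 - p ^ (4 * i + 4 + 8 * r)) * rr_coeff p i r\<bar> \<le> p ^ r * K"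
        using p by (intro mult_mono[OF power_decreasing K(1)]) auto
      then show ?thesis using p by (simp add: rr_term2_def abs_mult mult_ac)
    qed
    then show "\<forall>\<^sub>F (r, i) in at_top \<times>\<^sub>F sequentially. norm (rr_term2 p i r) \<le> K * p ^ r"
      by (intro always_eventually) auto
    show "summable (\<lambda>r. K * p ^ r)"
      using p by (intro summable_mult) auto
  qed simp
  also have "(\<Sum>r :: nat. if r = 0 then euler_phi (p\<^sup>2) else 0) = euler_phi (p\<^sup>2)"
    using sums_single[of 0 "\<lambda>_. euler_phi (p\<^sup>2)"] by (simp add: sums_iff)
  finally show ?thesis .
qed

text \<open>The bilateral terms at n = r and n = -(r + 1) have opposite signs; pairing them produces
  the factor 1 - p^(4+8r) or 1 - p^(2+4r).\<close>

lemma theta_eq_rr_series: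
  "(\<Sum>r. rr_term2 p 0 r) = theta p 5 1" "(\<Sum>r. rr_term1 p 0 r) = theta p 5 3"
proof -
  have n: "norm (p\<^sup>2) < 1" using p by (simp add: power_less_one_iff)
  have c0: "rr_coeff p 0 r = 1" for r
    using qpoch_nonzero[OF n] by (simp add: rr_coeff_def)
  have split: "theta p 5 b = (\<Sum>r. (-1) ^ r * (p ^ (nat (5 * int r ^ 2 + b * int r)) - p ^ (nat (5 * int (Suc r) ^ 2 - b * int (Suc r)))))"
    if b: "b \<in> {1, 3}" for b
  proof -
    let ?t = "\<lambda>n. (-1) powi n * p powi (5 * n\<^sup>2 + b * n)"
    have sm: "?t summable_on UNIV"
      using p by (intro abs_summable_summable[OF theta_summable]) auto
    have nn: "0 \<le> 5 * n\<^sup>2 + b * n" for n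
      using quadratic_ge_abs_strict[of b 5 n] b by auto
    have 1: "((\<lambda>r. ?t (int r)) has_sum infsum ?t (range int)) UNIV"
      using has_sum_infsum[OF summable_on_subset_banach[OF sm subset_UNIV], of "range int"]
      unfolding has_sum_reindex[OF inj_of_nat] by (simp add: o_def)
    have inj: "inj (\<lambda>r. - int (Suc r))" by (simp add: inj_def)
    have 2: "((\<lambda>r. ?t (- int (Suc r))) has_sum infsum ?t (range (\<lambda>r. - int (Suc r)))) UNIV"
      using has_sum_infsum[OF summable_on_subset_banach[OF sm subset_UNIV], of "range (\<lambda>r. - int (Suc r))"]
      unfolding has_sum_reindex[OF inj] by (simp add: o_def)
    have U: "range int \<union> range (\<lambda>r. - int (Suc r)) = UNIV"
    proof (intro equalityI subsetI)
      fix x :: int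
      show "x \<in> range int \<union> range (\<lambda>r. - int (Suc r))"
        by (cases x rule: int_cases) auto
    qed simp
    have "theta p 5 b = infsum ?t (range int \<union> range (\<lambda>r. - int (Suc r)))"
      unfolding U theta_def ..
    also have "\<dots> = infsum ?t (range int) + infsum ?t (range (\<lambda>r. - int (Suc r)))"
      by (intro infsum_Un_disjoint summable_on_subset_banach[OF sm]) auto
    finally have "theta p 5 b = (\<Sum>r. ?t (int r) + ?t (- int (Suc r)))"
      using sums_add[OF has_sum_imp_sums[OF 1] has_sum_imp_sums[OF 2]] by (simp add: sums_iff)
    moreover have "?t (int r) + ?t (- int (Suc r)) = 
       (-1) ^ r * (p ^ (nat (5 * int r ^ 2 + b * int r)) - p ^ (nat (5 * int (Suc r) ^ 2 - b * int (Suc r))))" for r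
      using nn[of "int r"] nn[of "- int (Suc r)"]
      by (simp add: power_int_nonneg_exp minus_one_powi right_diff_distrib del: of_nat_Suc)
    ultimately show ?thesis by (simp only:)
  qed
  have e1: "nat (5 * int r ^ 2 + 1 * int r) = r * (5 * r + 1)" 
      "nat (5 * int (Suc r) ^ 2 - 1 * int (Suc r)) = r * (5 * r + 1) + (4 + 8 * r)" 
      "nat (5 * int r ^ 2 + 3 * int r) = r * (5 * r + 1) + 2 * r" 
      "nat (5 * int (Suc r) ^ 2 - 3 * int (Suc r)) = r * (5 * r + 1) + 2 * r + (2 + 4 * r)" for r
    by (simp_all add: nat_eq_iff algebra_simps power2_eq_square)
  have "(-1) ^ r * p ^ (m + 4 * 0 * r) * (1 - p ^ (4 * 0 + 4 + 8 * r)) * 1 = (-1) ^ r * (p ^ m - p ^ (m + (4 + 8 * r)))" for m r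
    by (simp only: power_add right_diff_distrib mult_0_right mult_0 power_0 mult_1_left mult_1_right mult_ac)
  then show "(\<Sum>r. rr_term2 p 0 r) = theta p 5 1"
    by (simp only: split[of 1, OF insertI1] e1 rr_term2_def c0)
  have "(-1) ^ r * p ^ (m + 4 * 0 * r + 2 * r) * (1 - p ^ (2 * 0 + 2 + 4 * r)) * 1 = (-1) ^ r * (p ^ (m + 2 * r) - p ^ (m + 2 * r + (2 + 4 * r)))" for m r
    by (simp only: power_add right_diff_distrib mult_0_right mult_0 power_0 mult_1_left mult_1_right mult_ac)
  then show "(\<Sum>r. rr_term1 p 0 r) = theta p 5 3"
    by (simp only: split[of 3, OF insertI2[OF insertI1]] e1 rr_term1_def c0)
qed

end

lemma euler_phi_pos:
  fixes q :: real
  assumes "0 \<le> q" "q < 1"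
  shows "0 < euler_phi q"
proof -
  have n: "norm q < 1" using assms by simp
  have "0 \<le> qpoch q n" for n
    unfolding qpoch_def using assms by (intro prod_nonneg) (auto intro!: power_le_one simp del: power_Suc)
  then have "0 \<le> euler_phi q"
    using qpoch_tendsto[OF n] by (intro tendsto_lowerbound[OF qpoch_tendsto[OF n]]) auto
  then show ?thesis using euler_phi_nonzero[OF n] by simp
qed

text \<open>A solution of the tail recurrence that stays at least 1 must be the value of the
  fraction. All denominators being at least 1, each level shrinks the error by a factor of at most
  q; the bound is uniform in j because the induction moves to the next tail.\<close>

lemma rr_denom_tendsto:
  fixes T :: "nat \<Rightarrow> real"
  assumes q: "0 < q" "q < 1"
    and T: "\<And>j. 1 \<le> T j" "\<And>j. T j = 1 + q ^ Suc j / T (Suc j)"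
  shows "(\<lambda>n. rr_denom q j n) \<longlonglongrightarrow> T j"
proof -
  have ge1: "1 \<le> rr_denom q j n" for j n
  proof (induction n arbitrary: j)
    case (Suc n)
    have "0 \<le> q ^ Suc j / rr_denom q (Suc j) n"
      using q order.trans[OF zero_le_one Suc[of "Suc j"]] by (intro divide_nonneg_nonneg) auto
    then show ?case by simp
  qed simp
  have close: "\<bar>rr_denom q j n - T j\<bar> \<le> q ^ n" for j n
  proof (induction n arbitrary: j)
    case 0
    have "q ^ Suc j / T (Suc j) \<le> 1 / 1"
      using q T(1)[of "Suc j"] by (intro frac_le power_le_one) auto
    moreover have "0 \<le> q ^ Suc j / T (Suc j)"
      using q order.trans[OF zero_le_one T(1)[of "Suc j"]] by (intro divide_nonneg_nonneg) auto
    ultimately show ?case using T(2)[of j] by simp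
  next
    case (Suc n)
    define x y where "x = rr_denom q (Suc j) n" and "y = T (Suc j)"
    have xy: "1 \<le> x" "1 \<le> y" unfolding x_def y_def by (rule ge1, rule T(1))
    have "rr_denom q j (Suc n) - T j = q ^ Suc j * (1 / x - 1 / y)"
      unfolding T(2)[of j] by (simp add: x_def y_def right_diff_distrib)
    also have "1 / x - 1 / y = (y - x) / (x * y)"
      using xy by (simp add: field_simps)
    finally have "\<bar>rr_denom q j (Suc n) - T j\<bar> = q ^ Suc j * (\<bar>y - x\<bar> / (x * y))"
      using q xy by (simp add: abs_mult)
    also have "\<dots> \<le> q * (q ^ n / 1)"
    proof (intro mult_mono frac_le)
      show "q ^ Suc j \<le> q" using q power_decreasing[of 1 "Suc j" q] by simp
      show "\<bar>y - x\<bar> \<le> q ^ n" using Suc.IH[of "Suc j"] by (simp add: x_def y_def abs_minus_commute)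
      show "1 \<le> x * y" using mult_mono[of 1 x 1 y] xy by simp
    qed (use q xy in auto)
    finally show ?case by simp
  qed
  have "(\<lambda>n. rr_denom q j n - T j) \<longlonglongrightarrow> 0"
  proof (rule Lim_null_comparison[OF always_eventually])
    show "\<forall>n. norm (rr_denom q j n - T j) \<le> q ^ n" using close by simp
    show "(\<lambda>n. q ^ n) \<longlonglongrightarrow> 0" using q by (intro LIMSEQ_power_zero) auto
  qed
  then show ?thesis by (rule LIM_zero_cancel)
qed

text \<open>Quotients of consecutive series satisfy the tail recurrence. Their positivity starts
  from the positive limit at large index and descends through the recurrence, whose coefficients are
  positive; this also makes both theta series positive.\<close>

lemma rogers_ramanujan_cf_eq_theta:
  assumes p: "0 < p" "p < 1"
  shows "0 < theta p 5 1" "0 < theta p 5 3"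
    and "rogers_ramanujan_cf (p\<^sup>2) = root 5 (p\<^sup>2) * (theta p 5 3 / theta p 5 1)"
proof -
  have q: "0 < p\<^sup>2" "p\<^sup>2 < 1" using p by (auto simp: power_less_one_iff)
  define h where "h = (\<lambda>i. \<Sum>r. rr_term2 p i r)"
  have rec: "h i = h (Suc i) + (p\<^sup>2) ^ Suc i * h (Suc (Suc i))" for i
  proof -
    have "p ^ (2 * i + 2) = (p\<^sup>2) ^ Suc i" unfolding power_mult[symmetric] by simp
    then show ?thesis
      using rr_recurrence2[OF p, of i] unfolding h_def rr_recurrence1[OF p] by simp
  qed
  have "\<forall>\<^sub>F i in sequentially. 0 < h i"
    using rr_series2_tendsto[OF p] euler_phi_pos[of "p\<^sup>2"] q unfolding h_def by (intro order_tendstoD(1)) auto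
  then obtain N where N: "\<And>i. N \<le> i \<Longrightarrow> 0 < h i"
    by (auto simp: eventually_sequentially)
  have "0 < h i" if "N \<le> i + k" for i k
    using that
  proof (induction k arbitrary: i)
    case (Suc k)
    then have "0 < h (Suc i)" "0 < h (Suc (Suc i))" by auto
    then show ?case unfolding rec[of i] using q by (intro add_pos_pos mult_pos_pos) auto
  qed (use N in auto)
  then have pos: "0 < h i" for i by (metis le_add2)
  define T where "T = (\<lambda>i. h i / h (Suc i))"
  have Trec: "T i = 1 + (p\<^sup>2) ^ Suc i / T (Suc i)" for i
    using pos[of "Suc i"] pos[of "Suc (Suc i)"] unfolding T_def rec[of i] by (simp add: field_simps)
  have "0 < T i" for i unfolding T_def using pos by simp
  then have "0 \<le> (p\<^sup>2) ^ Suc i / T (Suc i)" for i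
    using q by (intro divide_nonneg_nonneg less_imp_le[of _ "T _"]) auto
  then have T1: "1 \<le> T i" for i
    unfolding Trec[of i] by simp
  have h0: "h 0 = theta p 5 1" "h (Suc 0) = theta p 5 3"
    using theta_eq_rr_series[OF p] rr_recurrence1[OF p, of 0] by (simp_all add: h_def)
  show th: "0 < theta p 5 1" "0 < theta p 5 3"
    using pos[of 0] pos[of "Suc 0"] h0 by simp_all
  have "(\<lambda>n. root 5 (p\<^sup>2) / rr_denom (p\<^sup>2) 0 n) \<longlonglongrightarrow> root 5 (p\<^sup>2) / T 0"
    using T1[of 0] by (intro tendsto_divide tendsto_const rr_denom_tendsto q T1 Trec) auto
  then show "rogers_ramanujan_cf (p\<^sup>2) = root 5 (p\<^sup>2) * (theta p 5 3 / theta p 5 1)"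
    unfolding rogers_ramanujan_cf_def T_def using th by (simp add: limI h0)
qed

section \<open>The fifth power of the continued fraction, and u\<close>

text \<open>This is R^5 as a function of p, the square root of q. Taking the fifth power removes
  \<open>root 5\<close> and leaves a function that is continuous at p = 0.\<close>

definition theta_quotient :: "real \<Rightarrow> real" where
  "theta_quotient p = p\<^sup>2 * (theta p 5 3 / theta p 5 1) ^ 5"

lemma theta_quotient_pos:
  assumes "0 < p" "p < 1"
  shows "0 < theta_quotient p"
  using rogers_ramanujan_cf_eq_theta[OF assms] assms by (simp add: theta_quotient_def)

lemma rogers_ramanujan_cf_power5:
  assumes q: "0 < q" "q < 1"
  shows "rogers_ramanujan_cf q ^ 5 = theta_quotient (sqrt q)"
proof -
  have "0 < sqrt q" "sqrt q < 1" using q by auto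
  from rogers_ramanujan_cf_eq_theta(3)[OF this] show ?thesis
    using q by (simp add: theta_quotient_def power_mult_distrib del: times_divide_eq_right)
qed

text \<open>Over the denominator q G^5 H^5, the numerator of 1/R^5 - 11 - R^5 is exactly the form of
  degree ten evaluated by \<open>theta_fifth_power_identity\<close>.\<close>

lemma rr_u_eq_euler_phi:
  assumes q: "0 < q" "q < 1"
  shows "rr_u q = euler_phi q ^ 6 / (q * euler_phi (q ^ 5) ^ 6)"
proof -
  define p where "p = sqrt q"
  have p: "0 < p" "p < 1" "p\<^sup>2 = q" using q by (auto simp: p_def)
  have q5: "q ^ 5 < 1" using q by (simp add: power_less_one_iff)
  define G H f f5 where "G = theta p 5 1" and "H = theta p 5 3" and "f = euler_phi q" and "f5 = euler_phi (q ^ 5)"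
  have pos: "0 < G" "0 < H" "0 < f" "0 < f5"
    unfolding G_def H_def f_def f5_def using rogers_ramanujan_cf_eq_theta[OF p(1,2)] q q5 euler_phi_pos by auto
  have "p ^ 10 = q ^ 5" unfolding p(3)[symmetric] by (simp flip: power_mult)
  then have GH: "G * H = f * f5"
    using theta_product_eq_euler_phi[of p] p unfolding G_def H_def f_def f5_def by simp
  have main: "(G ^ 10 - 11 * q * (G ^ 5 * H ^ 5) - q\<^sup>2 * H ^ 10) * f5 = f ^ 11"
    using theta_fifth_power_identity[OF p(1,2)] unfolding p(3) G_def H_def f_def f5_def .
  have GH5: "G ^ 5 * H ^ 5 = f ^ 5 * f5 ^ 5" using GH by (simp flip: power_mult_distrib)
  have "rr_u q = 1 / (q * (H / G) ^ 5) - 11 - q * (H / G) ^ 5"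
    unfolding rr_u_def rogers_ramanujan_cf_power5[OF q] p_def[symmetric] theta_quotient_def p(3) G_def H_def ..
  also have "\<dots> = (G ^ 10 - 11 * q * (G ^ 5 * H ^ 5) - q\<^sup>2 * H ^ 10) / (q * (G ^ 5 * H ^ 5))"
    using pos q by (simp add: field_simps power_divide eval_nat_numeral)
  also have "G ^ 10 - 11 * q * (G ^ 5 * H ^ 5) - q\<^sup>2 * H ^ 10 = f ^ 11 / f5"
    using main pos by (simp add: field_simps)
  also have "(f ^ 11 / f5) / (q * (G ^ 5 * H ^ 5)) = f ^ 6 / (q * f5 ^ 6)"
    unfolding GH5 using pos q by (simp add: field_simps flip: power_add power_Suc)
  finally show ?thesis unfolding f_def f5_def .
qed

text \<open>The constants b^2, namely 9 and 1, add 8GH to the Wronskian. In the logarithmic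
  derivative this term cancels the 2/p coming from the prefactor p^2, leaving only the contribution
  of f^6 / (GH).\<close>

lemma theta_quotient_has_derivative:
  assumes p: "0 < p" "p < 1"
  shows "(theta_quotient has_field_derivative
     theta_quotient p * (2 / p) * (euler_phi (p\<^sup>2) ^ 5 / euler_phi (p ^ 10))) (at p)"
proof -
  have p': "p \<noteq> 0" "\<bar>p\<bar> < 1" "norm p < 1" using p by auto
  obtain D1 where D1: "((\<lambda>x. theta x 5 1) has_field_derivative D1) (at p)"
      "theta_moment 2 p 5 1 = 20 * p * D1 + theta p 5 1"
    using theta_moment_2_deriv[OF p'(1,2), of 1 5] by auto
  obtain D3 where D3: "((\<lambda>x. theta x 5 3) has_field_derivative D3) (at p)"
      "theta_moment 2 p 5 3 = 20 * p * D3 + 9 * theta p 5 3"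
    using theta_moment_2_deriv[OF p'(1,2), of 3 5] by auto
  define G H f f5 where "G = theta p 5 1" and "H = theta p 5 3" and "f = euler_phi (p\<^sup>2)" and "f5 = euler_phi (p ^ 10)"
  have q: "0 \<le> p\<^sup>2" "p\<^sup>2 < 1" "0 \<le> p ^ 10" "p ^ 10 < 1" using p by (auto simp: power_less_one_iff)
  have pos: "0 < G" "0 < H" "0 < f" "0 < f5"
    unfolding G_def H_def f_def f5_def using rogers_ramanujan_cf_eq_theta[OF p] q euler_phi_pos by auto
  have GH: "G * H = f * f5"
    using theta_product_eq_euler_phi[OF p'(1,3)] unfolding G_def H_def f_def f5_def .
  have "(20 * p * D3 + 9 * H) * G - H * (20 * p * D1 + G) = 2 * (2 * f ^ 3)\<^sup>2"
    using theta_wronskian[OF p'(1,3)] unfolding D1(2) D3(2) jacobi_cube[OF p'(1,3)] G_def H_def f_def .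
  then have "20 * p * (D3 * G - H * D1) + 8 * (G * H) = 8 * f ^ 6"
    by (simp add: algebra_simps eval_nat_numeral)
  then have W: "5 * p * (D3 * G - H * D1) = 2 * f ^ 6 - 2 * (f * f5)"
    unfolding GH by simp
  have "(theta_quotient has_field_derivative
     2 * p * (H / G) ^ 5 + p\<^sup>2 * (5 * (H / G) ^ 4 * ((D3 * G - H * D1) / G\<^sup>2))) (at p)"
    unfolding theta_quotient_def[abs_def]
    using pos by (auto intro!: derivative_eq_intros D1(1) D3(1) simp: G_def H_def power2_eq_square)
  also have "2 * p * (H / G) ^ 5 + p\<^sup>2 * (5 * (H / G) ^ 4 * ((D3 * G - H * D1) / G\<^sup>2))
     = (p\<^sup>2 * (H / G) ^ 5) * (2 / p) + p * (H / G) ^ 5 * ((5 * p * (D3 * G - H * D1)) / (G * H))"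
    using p pos by (simp add: field_simps eval_nat_numeral)
  also have "\<dots> = (p\<^sup>2 * (H / G) ^ 5) * (2 / p) * (f ^ 5 / f5)"
    unfolding W GH using p pos by (simp add: field_simps eval_nat_numeral)
  finally show ?thesis
    unfolding theta_quotient_def[of p] G_def H_def f_def f5_def .
qed

lemma theta_at_0:
  assumes "\<bar>b\<bar> < a"
  shows "theta (0 :: real) a b = 1"
proof -
  have "a * n\<^sup>2 + b * n \<noteq> 0" if "n \<noteq> 0" for n
    using quadratic_ge_abs_strict[OF assms, of n] that by linarith
  then have "theta (0 :: real) a b = (\<Sum>\<^sub>\<infinity>n\<in>{0 :: int}. 1)"
    unfolding theta_def by (intro infsum_cong_neutral) auto
  then show ?thesis by simp
qed

lemma theta_quotient_tendsto_0: "theta_quotient \<midarrow>0\<rightarrow> 0"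
proof -
  have "isCont (\<lambda>x :: real. theta x 5 b) 0" if "\<bar>b\<bar> < 5" for b
    using theta_has_derivative[of 0 b 5] that by (intro DERIV_isCont) auto
  then have "isCont theta_quotient 0"
    unfolding theta_quotient_def[abs_def] by (intro continuous_intros) (auto simp: theta_at_0)
  then show ?thesis
    unfolding isCont_def by (simp add: theta_quotient_def)
qed

section \<open>The change of variables\<close>

lemma rr_u_has_derivative:
  assumes q: "0 < q" "q < 1"
  obtains D where "(rr_u has_field_derivative - D) (at q)" "0 < D"
    "D = sqrt ((rr_u q + 11)\<^sup>2 + 4) * (euler_phi q ^ 5 / (q * euler_phi (q ^ 5)))"
proof
  define E where "E = euler_phi q ^ 5 / (q * euler_phi (q ^ 5))"
  define \<rho> where "\<rho> = theta_quotient (sqrt q)"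
  have sq: "0 < sqrt q" "sqrt q < 1" using q by auto
  have pos: "0 < \<rho>" unfolding \<rho>_def by (rule theta_quotient_pos[OF sq])
  have q5: "q ^ 5 < 1" using q by (simp add: power_less_one_iff)
  have E: "0 < E" unfolding E_def using q q5 euler_phi_pos by simp
  have s10: "sqrt q ^ 10 = q ^ 5"
  proof -
    have "sqrt q ^ 10 = ((sqrt q)\<^sup>2) ^ 5" by (simp flip: power_mult)
    then show ?thesis using q by simp
  qed
  have u: "rr_u x = 1 / theta_quotient (sqrt x) - 11 - theta_quotient (sqrt x)" if "0 < x" "x < 1" for x
    unfolding rr_u_def rogers_ramanujan_cf_power5[OF that] ..
  let ?d = "\<rho> * (2 / sqrt q) * (euler_phi q ^ 5 / euler_phi (q ^ 5)) * (inverse (sqrt q) / 2)"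
  have "((\<lambda>x. theta_quotient (sqrt x)) has_field_derivative ?d) (at q)"
    using DERIV_chain2[OF theta_quotient_has_derivative[OF sq] DERIV_real_sqrt[OF q(1)]] q
    unfolding \<rho>_def s10 by simp
  also have "?d = \<rho> * E"
    unfolding E_def using q by (simp add: field_simps)
  finally have d: "((\<lambda>x. theta_quotient (sqrt x)) has_field_derivative \<rho> * E) (at q)" .
  have "((\<lambda>x. 1 / theta_quotient (sqrt x) - 11 - theta_quotient (sqrt x)) has_field_derivative - ((1 / \<rho> + \<rho>) * E)) (at q)"
    using pos by (auto intro!: derivative_eq_intros d simp: \<rho>_def[symmetric] field_simps power2_eq_square)
  then have D: "(rr_u has_field_derivative - ((1 / \<rho> + \<rho>) * E)) (at q)"
    by (rule has_field_derivative_transform_within_open[where S = "{0<..<1}"]) (use q u in auto)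
  have "(rr_u q + 11)\<^sup>2 + 4 = (1 / \<rho> + \<rho>)\<^sup>2"
    using pos unfolding u[OF q] \<rho>_def[symmetric] by (simp add: field_simps power2_eq_square)
  then have s: "sqrt ((rr_u q + 11)\<^sup>2 + 4) = 1 / \<rho> + \<rho>"
    using pos by (simp add: add_nonneg_nonneg)
  show "(rr_u has_field_derivative - (sqrt ((rr_u q + 11)\<^sup>2 + 4) * (euler_phi q ^ 5 / (q * euler_phi (q ^ 5))))) (at q)"
    unfolding s using D by (simp only: E_def)
  show "0 < sqrt ((rr_u q + 11)\<^sup>2 + 4) * (euler_phi q ^ 5 / (q * euler_phi (q ^ 5)))"
    unfolding s E_def[symmetric] using E pos by (intro mult_pos_pos add_pos_pos) auto
qed simp

lemma rr_u_strict_antimono: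
  assumes "0 < x" "x < y" "y < 1"
  shows "rr_u y < rr_u x"
proof (rule DERIV_neg_imp_decreasing[OF assms(2)])
  fix z assume z: "x \<le> z" "z \<le> y"
  then have "0 < z" "z < 1" using assms by auto
  from rr_u_has_derivative[OF this] obtain D where "(rr_u has_field_derivative - D) (at z)" "0 < D" by blast
  then show "\<exists>d. (rr_u has_field_derivative d) (at z) \<and> d < 0" by force
qed

lemma rr_u_at_top:
  assumes "0 < a" "a < 1"
  obtains q where "0 < q" "q < a" "Y \<le> rr_u q"
proof -
  \<comment> \<open>Here 12 = 11 + 1: the 11 is subtracted in u, and the 1 bounds R^5.\<close>
  define e where "e = min 1 (1 / (\<bar>Y\<bar> + 12))"
  have e: "0 < e" unfolding e_def by simp
  obtain d where d: "0 < d" "\<And>p. p \<noteq> 0 \<Longrightarrow> \<bar>p\<bar> < d \<Longrightarrow> \<bar>theta_quotient p\<bar> < e"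
    using LIM_D[OF theta_quotient_tendsto_0 e] by (auto simp: abs_minus_commute)
  define p where "p = min (d / 2) (sqrt a / 2)"
  have p: "0 < p" "p < d" "p < sqrt a" using d assms unfolding p_def by (auto simp: min_less_iff_disj)
  have p1: "p < 1"
    using p(3) assms real_sqrt_lt_1_iff[of a] by linarith
  have q: "0 < p\<^sup>2" "p\<^sup>2 < a"
    using p assms power_strict_mono[of p "sqrt a" 2] by auto
  have pos: "0 < theta_quotient p" by (rule theta_quotient_pos[OF p(1) p1])
  have less: "theta_quotient p < e" using d(2)[of p] p pos by simp
  have "\<bar>Y\<bar> + 12 \<le> 1 / theta_quotient p"
  proof -
    have "theta_quotient p \<le> 1 / (\<bar>Y\<bar> + 12)" using less unfolding e_def by simp
    then show ?thesis using pos by (simp add: field_simps)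
  qed
  moreover have "e \<le> 1" unfolding e_def by simp
  moreover have "rr_u (p\<^sup>2) = 1 / theta_quotient p - 11 - theta_quotient p"
    unfolding rr_u_def using q assms p by (simp add: rogers_ramanujan_cf_power5)
  ultimately have "Y \<le> rr_u (p\<^sup>2)" using less by linarith
  with q show ?thesis by (rule that)
qed

lemma rr_u_image:
  assumes a: "0 < a" "a < 1"
  shows "(\<lambda>q. rr_u q - rr_u a) ` {0<..a} = {0..}"
proof (intro equalityI subsetI)
  fix y assume "y \<in> (\<lambda>q. rr_u q - rr_u a) ` {0<..a}"
  then obtain q where q: "0 < q" "q \<le> a" "y = rr_u q - rr_u a" by auto
  then show "y \<in> {0..}" using rr_u_strict_antimono[of q a] a by (cases "q = a") auto
next
  fix y :: real assume y: "y \<in> {0..}"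
  obtain b where b: "0 < b" "b < a" "y + rr_u a \<le> rr_u b"
    using rr_u_at_top[OF a] by blast
  have "isCont rr_u x" if "b \<le> x \<and> x \<le> a" for x
  proof -
    have "0 < x" "x < 1" using that a b by auto
    from rr_u_has_derivative[OF this] show ?thesis using DERIV_isCont by blast
  qed
  then have "\<exists>x. b \<le> x \<and> x \<le> a \<and> rr_u x = y + rr_u a"
    using y b by (intro IVT2) auto
  then obtain x where "b \<le> x" "x \<le> a" "rr_u x = y + rr_u a" by blast
  then show "y \<in> (\<lambda>q. rr_u q - rr_u a) ` {0<..a}"
    using b by (intro image_eqI[of _ _ x]) auto
qed

section \<open>The two integrands and the substitution\<close>

text \<open>The right integrand in the variable t = x + u(a). Under the substitution t becomes u(q),
  so no dependence on a remains in the kernel.\<close>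

definition F_kernel :: "real \<Rightarrow> real \<Rightarrow> real" where
  "F_kernel k t = 1 / (sqrt ((t + 11)\<^sup>2 + 4) * t powr (k + 1))"

text \<open>The first two bases are conjugate with imaginary parts 2 and -2, hence off the branch
  cut. Their principal square roots are conjugate too, and the product is the modulus sqrt((t +
  11)^2 + 4).\<close>

lemma F_integrand_eq_kernel:
  assumes u: "0 < u" and x: "0 \<le> x"
  shows "F_integrand (11 + 2 * \<i> + of_real u) (11 - 2 * \<i> + of_real u) (of_real u) (1 / 2) (1 / 2) (of_real k + 1) x
     = of_real (F_kernel k (x + u))"
proof -
  define z where "z = Complex (x + u + 11) 2"
  have z: "of_real x + (11 + 2 * \<i> + of_real u) = z" "of_real x + (11 - 2 * \<i> + of_real u) = cnj z"
    by (simp_all add: z_def complex_eq_iff)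
  have "z \<noteq> 0" by (simp add: z_def complex_eq_iff)
  have "cnj z powr (1 / 2) = cnj (z powr (1 / 2))"
    using cnj_powr[of z "1 / 2"] \<open>z \<noteq> 0\<close> by (simp add: z_def)
  then have "z powr (1 / 2) * cnj z powr (1 / 2) = of_real ((cmod (z powr (1 / 2)))\<^sup>2)"
    by (simp only: complex_norm_square)
  also have "(cmod (z powr (1 / 2)))\<^sup>2 = cmod z"
    using \<open>z \<noteq> 0\<close> by (simp add: csqrt_conv_powr[symmetric] flip: norm_power)
  also have "cmod z = sqrt ((x + u + 11)\<^sup>2 + 4)"
    by (simp add: z_def cmod_def)
  finally have 1: "z powr (1 / 2) * cnj z powr (1 / 2) = of_real (sqrt ((x + u + 11)\<^sup>2 + 4))" .
  have 2: "(of_real x + of_real u) powr (of_real k + 1 :: complex) = of_real ((x + u) powr (k + 1))"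
    using u x powr_of_real[of "x + u" "k + 1"] by simp
  show ?thesis
    unfolding F_integrand_def z 1 2 F_kernel_def by simp
qed

text \<open>Positivity of u keeps the kernel continuous at x = 0. At infinity the square root is at
  least x and the power at least x^(k+1), so x^(-k-2) dominates.\<close>

lemma F_kernel_integrable:
  assumes k: "0 \<le> k" and u: "0 < u"
  shows "(\<lambda>x. F_kernel k (x + u)) absolutely_integrable_on {0..}"
proof -
  let ?f = "\<lambda>x. F_kernel k (x + u)"
  have pos: "0 < (t + 11)\<^sup>2 + (4 :: real)" for t by (simp add: add_nonneg_pos)
  have cont: "continuous_on {0..} ?f"
    unfolding F_kernel_def using u pos
    by (intro continuous_intros) (auto simp: less_imp_neq[symmetric])
  have nonneg: "0 \<le> ?f x" for x
    unfolding F_kernel_def by simp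
  have "?f integrable_on {0..1}"
    by (intro integrable_continuous_real continuous_on_subset[OF cont]) auto
  moreover have "?f integrable_on {1..}"
  proof (rule measurable_bounded_by_integrable_imp_integrable)
    show "?f \<in> borel_measurable (lebesgue_on {1..})"
      by (intro continuous_imp_measurable_on_sets_lebesgue continuous_on_subset[OF cont]) auto
    show "(\<lambda>x. x powr - (k + 2)) integrable_on {1..}"
      using has_integral_powr_to_inf[of "- (k + 2)" 1] k by (auto simp: integrable_on_def)
    show "norm (?f x) \<le> x powr - (k + 2)" if "x \<in> {1..}" for x
    proof -
      have x: "1 \<le> x" using that by simp
      have "x \<le> sqrt ((x + u + 11)\<^sup>2 + 4)"
        using x u by (intro real_le_rsqrt order.trans[OF power_mono[of x "x + u + 11" 2]]) auto
      moreover have "x powr (k + 1) \<le> (x + u) powr (k + 1)"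
        using x u k by (intro powr_mono2) auto
      ultimately have "x * x powr (k + 1) \<le> sqrt ((x + u + 11)\<^sup>2 + 4) * (x + u) powr (k + 1)"
        using x by (intro mult_mono) auto
      moreover have "x * x powr (k + 1) = x powr (k + 2)"
        using x powr_add[of x 1 "k + 1"] by (simp add: add.commute)
      ultimately have "?f x \<le> 1 / x powr (k + 2)"
        unfolding F_kernel_def using x u pos[of "x + u"] by (intro divide_left_mono mult_pos_pos) auto
      then show ?thesis using nonneg[of x] by (simp only: powr_minus_divide real_norm_def abs_of_nonneg)
    qed
  qed auto
  ultimately have "?f integrable_on ({0..1} \<union> {1..})"
    by (rule integrable_Un[rotated 1]) (auto intro: negligible_subset[of "{1}"])
  also have "{0..1} \<union> {1..} = {0 :: real..}" by auto
  finally show ?thesis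
    using nonneg by (intro nonnegative_absolutely_integrable_1) auto
qed

lemma ramanujan_f_minus: "ramanujan_f (- q) = euler_phi q"
  by (simp add: ramanujan_f_def euler_phi_def)

text \<open>With x = f5 / f one has u = 1 / (q x^6), so u^(-k-1) = q^(k+1) x^(6k+6). The derivative
  supplies f^5 / (q f5) = f^4 / (q x), lowering both exponents by one: this is the origin of 6k + 5
  and f^4.\<close>

lemma substituted_integrand_eq:
  assumes q: "0 < q" "q < 1"
  shows "sqrt ((rr_u q + 11)\<^sup>2 + 4) * (euler_phi q ^ 5 / (q * euler_phi (q ^ 5))) * F_kernel k (rr_u q)
     = (euler_phi (q ^ 5) / euler_phi q) powr (6 * k + 5) * euler_phi q ^ 4 * q powr k"
proof -
  define f f5 where "f = euler_phi q" and "f5 = euler_phi (q ^ 5)"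
  have q5: "q ^ 5 < 1" using q by (simp add: power_less_one_iff)
  have pos: "0 < f" "0 < f5" unfolding f_def f5_def using q q5 euler_phi_pos by auto
  define x where "x = f5 / f"
  have x: "0 < x" unfolding x_def using pos by simp
  have u: "rr_u q = 1 / (q * x ^ 6)"
    unfolding rr_u_eq_euler_phi[OF q] x_def f_def[symmetric] f5_def[symmetric] by (simp add: power_divide)
  have "x ^ 6 = x powr 6" using x by (simp add: powr_realpow[of x 6, simplified])
  then have "(x ^ 6) powr (k + 1) = x powr (6 * (k + 1))"
    by (simp only: powr_powr)
  then have "(q * x ^ 6) powr (k + 1) = q powr (k + 1) * x powr (6 * (k + 1))"
    using q x by (simp only: powr_mult)
  also have "\<dots> = (q * q powr k) * (x * x powr (6 * k + 5))"
    using q x powr_add[of q 1 k] powr_add[of x 1 "6 * k + 5"] by (simp add: algebra_simps)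
  finally have *: "(q * x ^ 6) powr (k + 1) = (q * q powr k) * (x * x powr (6 * k + 5))" .
  have "rr_u q powr (k + 1) = 1 / (q * x ^ 6) powr (k + 1)"
    unfolding u using q x by (simp add: powr_divide)
  moreover have "sqrt ((rr_u q + 11)\<^sup>2 + 4) \<noteq> 0"
    by (simp add: add_nonneg_eq_0_iff)
  ultimately have "sqrt ((rr_u q + 11)\<^sup>2 + 4) * (f ^ 5 / (q * f5)) * F_kernel k (rr_u q) 
     = (f ^ 5 / (q * f5)) * (q * x ^ 6) powr (k + 1)"
    unfolding F_kernel_def by simp
  also have "\<dots> = (f ^ 5 / f5 * x) * (x powr (6 * k + 5) * q powr k)"
    unfolding * using q by simp
  also have "f ^ 5 / f5 * x = f ^ 4"
    unfolding x_def using pos by (simp add: eval_nat_numeral)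
  finally show ?thesis
    unfolding f_def f5_def x_def by (simp only: mult_ac)
qed

text \<open>The two integrability claims ensure that neither side of the equation is the default
  value of \<open>integral\<close>.\<close>

theorem theorem3:
  fixes k a :: real
  assumes "2 * k \<in> \<nat>" and "0 < a" and "a < 1"
  shows "(\<lambda>q. (ramanujan_f (- (q ^ 5)) / ramanujan_f (- q)) powr (6 * k + 5)
               * ramanujan_f (- q) ^ 4 * q powr k) integrable_on {0..a}
    \<and> F_integrand (11 + 2 * \<i> + of_real (rr_u a)) (11 - 2 * \<i> + of_real (rr_u a))
         (of_real (rr_u a)) (1 / 2) (1 / 2) (of_real k + 1) integrable_on {0..}
    \<and> of_real (integral {0..a}
         (\<lambda>q. (ramanujan_f (- (q ^ 5)) / ramanujan_f (- q)) powr (6 * k + 5)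
               * ramanujan_f (- q) ^ 4 * q powr k))
       = F_integral (11 + 2 * \<i> + of_real (rr_u a)) (11 - 2 * \<i> + of_real (rr_u a))
           (of_real (rr_u a)) (1 / 2) (1 / 2) (of_real k + 1)"
proof -
  let ?g = "\<lambda>q. (ramanujan_f (- (q ^ 5)) / ramanujan_f (- q)) powr (6 * k + 5) * ramanujan_f (- q) ^ 4 * q powr k"
  let ?F = "F_integrand (11 + 2 * \<i> + of_real (rr_u a)) (11 - 2 * \<i> + of_real (rr_u a))
         (of_real (rr_u a)) (1 / 2) (1 / 2) (of_real k + 1)"
  let ?K = "\<lambda>x. F_kernel k (x + rr_u a)"
  note a = assms(2,3)
  have "2 * k \<ge> 0" using assms(1) by (auto elim: Nats_cases)
  then have k: "0 \<le> k" by simp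
  have u: "0 < rr_u a"
    using a euler_phi_pos[of a] euler_phi_pos[of "a ^ 5"] by (simp add: rr_u_eq_euler_phi power_less_one_iff)
  define D where "D = (\<lambda>q. - (sqrt ((rr_u q + 11)\<^sup>2 + 4) * (euler_phi q ^ 5 / (q * euler_phi (q ^ 5)))))"
  have deriv: "((\<lambda>q. rr_u q - rr_u a) has_field_derivative D q) (at q within {0<..a})" 
    and D_neg: "D q < 0" if "q \<in> {0<..a}" for q
  proof -
    have q: "0 < q" "q < 1" using that a by auto
    from rr_u_has_derivative[OF this] have *: "(rr_u has_field_derivative D q) (at q)" "D q < 0"
      unfolding D_def by auto
    show "D q < 0" by fact
    show "((\<lambda>q. rr_u q - rr_u a) has_field_derivative D q) (at q within {0<..a})"
      by (auto intro!: derivative_eq_intros has_field_derivative_at_within[OF *(1)])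
  qed
  have inj: "inj_on (\<lambda>q. rr_u q - rr_u a) {0<..a}"
  proof (rule linorder_inj_onI')
    fix x y assume "x \<in> {0<..a}" "y \<in> {0<..a}" "x < y"
    then show "rr_u x - rr_u a \<noteq> rr_u y - rr_u a"
      using rr_u_strict_antimono[of x y] a by auto
  qed
  have g_eq: "\<bar>D q\<bar> * ?K (rr_u q - rr_u a) = ?g q" if "q \<in> {0<..a}" for q
  proof -
    have "\<bar>D q\<bar> = - D q" using D_neg[OF that] by simp
    moreover have "0 < q" "q < 1" using that a by auto
    ultimately show ?thesis
      using substituted_integrand_eq[of q k]
      unfolding ramanujan_f_minus diff_add_cancel by (simp only: D_def minus_minus)
  qed
  \<comment> \<open>Only this side is shown to be absolutely integrable; the change of variables
    transports the property to the q side, and |D| accounts for the reversed orientation.\<close>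
  have K: "?K absolutely_integrable_on {0..}"
    by (rule F_kernel_integrable[OF k u])
  have "(\<lambda>q. \<bar>D q\<bar> * ?K (rr_u q - rr_u a)) absolutely_integrable_on {0<..a}
     \<and> integral {0<..a} (\<lambda>q. \<bar>D q\<bar> * ?K (rr_u q - rr_u a)) = integral {0..} ?K"
    using has_absolute_integral_change_of_variables_1'[OF _ deriv inj, of ?K "integral {0..} ?K"] K
    unfolding rr_u_image[OF a] by simp
  then have "((\<lambda>q. \<bar>D q\<bar> * ?K (rr_u q - rr_u a)) has_integral integral {0..} ?K) {0<..a}"
    using set_lebesgue_integral_eq_integral(1) has_integral_integral by metis
  then have "(?g has_integral integral {0..} ?K) {0<..a}"
    using g_eq by (rule has_integral_eq[rotated])
  \<comment> \<open>The substitution lives on the half-open interval because u is unbounded at 0.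
    Adding the endpoint changes a null set, so the value of the integrand there, including the
    convention for 0 powr k, has no effect.\<close>
  then have g: "(?g has_integral integral {0..} ?K) {0..a}"
    by (subst (asm) has_integral_spike_set_eq[where T = "{0..a}"]) (auto intro: negligible_subset[of "{0}"])
  have "(?K has_integral integral {0..} ?K) {0..}"
    using set_lebesgue_integral_eq_integral(1)[OF K] by (rule integrable_integral)
  from has_integral_linear[OF this bounded_linear_of_real]
  have "((\<lambda>x. of_real (?K x) :: complex) has_integral of_real (integral {0..} ?K)) {0..}"
    by (simp add: o_def)
  then have F: "(?F has_integral of_real (integral {0..} ?K)) {0..}"
    by (rule has_integral_eq[rotated]) (use F_integrand_eq_kernel[OF u] in auto)
  show ?thesis
    using g F unfolding F_integral_def by (auto simp: integral_unique has_integral_integrable)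
qed

end
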